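(* (Uniform attraction.) Let $B>0$. For every $\epsilon>0$ there is a time $T_{B,\epsilon}$, depending on $B$ and $\epsilon$, such that every fluid limit $(\bar N,\bar D,\bar W,\bar Y)$ under the utility-maximizing allocation with $|\bar N(0)|\le B$ has an attraction state $\bar N(\infty)$ (not depending on $\epsilon$) with $$|\bar N(t)-\bar N(\infty)|<\epsilon\qquad\text{for all } t>T_{B,\epsilon}.$$ Furthermore, the attraction state is a fixed point: $\bar N(\infty)=n^*(w)$ with $w=\bar W(\infty)$, where $\bar W(\infty)=\lim_{t\to\infty}\bar W(t)$ (this limit exists).
   Context: Network data: a finite set $\mathcal L$ of links and a finite set $\mathcal R$ of routes (job classes); each route $r\in\mathcal R$ is a nonempty subset of $\mathcal L$, and $r\ni\ell$ means that link $\ell$ belongs to route $r$. Link $\ell$ has capacity $c_\ell>0$. For each route, $\lambda_r>0$ is the arrival rate, $\nu_r>0$ the mean service requirement, and $\rho_r=\lambda_r\nu_r>0$ the offered load. The set of feasible allocations is $M=\{\Lambda\in\mathbb R^{\mathcal R}: \sum_{r\ni\ell}\Lambda_r\le c_\ell\ \forall\ell\in\mathcal L,\ \Lambda_r\ge0\ \forall r\in\mathcal R\}$, and $\rho=(\rho_r)\in M$. $\mathcal L^*$ denotes the set of bottleneck links: $\sum_{r\ni\ell}\rho_r=c_\ell$ for $\ell\in\mathcal L^*$, $\sum_{r\ni\ell}\rho_r<c_\ell$ for $\ell\notin\mathcal L^*$. $|x|=\sum_i|x_i|$. Utility functions: for each $r$, $U_r(n_r,\Lambda_r)$ is defined on $\mathbb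 R_+^2$, is second-order differentiable, and satisfies: $U_r(0,\Lambda_r)\equiv 0$; for $n_r>0$, $U_r$ is strictly increasing and strictly concave in $\Lambda_r$; for $\Lambda_r>0$, $\partial_2U_r(n_r,\Lambda_r)$ is strictly increasing in $n_r\ge 0$ with $\partial_2U_r(0,\Lambda_r)=0$ and $\lim_{n_r\to\infty}\partial_2U_r(n_r,\Lambda_r)=+\infty$. The utility-maximizing allocation $\Lambda(n)$ is the solution of $\max_{\Lambda\in M}\sum_rU_r(n_r,\Lambda_r)$ (components with $n_r>0$ are uniquely determined); it is assumed radially homogeneous: $\Lambda_r(an)=\Lambda_r(n)$ for all $a>0$ and all $r$ with $n_r>0$. Costs and fixed points: $C_r(n_r)=\nu_r\int_0^{n_r}\partial_2U_r(q,\rho_r)\,dq$. For $w=(w_\ell)_{\ell\in\mathcal L^*}$, $w_\ell\ge0$, $n^*(w)$ is the (unique) minimizer of $\sum_{r\in\mathcal R}C_r(n_r)$ subject to $\sum_{r\ni\ell}\nu_rn_r\ge w_\ell$ ($\ell\in\mathcal L^*$), $n_r\ge0$ ($r\in\mathcal R$); it is called the fixed point corresponding to workload $w$. Fluid limits: consider networks indexed by $k=1,2,\dots$, with the same links, routes, capacities and allocation rule $\Lambda(\cdot)$. In the $k$-th network, route-$r$ interarrival times $u^k_r(i)$ and service requirements $v^k_r(i)$ are, for each $r$, i.i.d. sequences (except possibly for the initial ones, $i=1$), mutually independent, with means $1/\lambda^k_r$ and $\nu^k_r$, where $\lambda_r^k\to\lambda_r$, $\nu^k_r\to\nu_r$,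 and $u^k_r(1)/k\to0$, $v^k_r(1)/k\to0$. Put $E^k_r(t)=\max\{i:u_r^k(1)+\dots+u^k_r(i)\le t\}$, $S^k_r(y)=\max\{i:v^k_r(1)+\dots+v^k_r(i)\le y\}$, $N^k_r(t)=N^k_r(0)+E^k_r(t)-S^k_r(D^k_r(t))$, $D^k_r(t)=\int_0^t\Lambda_r(N^k(s))1_{\{N^k_r(s)>0\}}ds$, and for $\ell\in\mathcal L^*$, $W^k_\ell(t)=\sum_{r\ni\ell}\nu^k_rN^k_r(t)$, $Y^k_\ell(t)=\sum_{r\ni\ell}(\rho_rt-D^k_r(t))$. A fluid limit $(\bar N,\bar D,\bar W,\bar Y)$ is a limit, uniform on compact time sets along a subsequence, of $\frac1k(N^k(kt),D^k(kt),W^k(kt),Y^k(kt))$ (with $\frac1kN^k(0)\to\bar N(0)$). Fluid limits are Lipschitz continuous and are characterized by: $\bar N_r(t)=\bar N_r(0)+\lambda_rt-\nu_r^{-1}\bar D_r(t)\ge0$; $\bar D_r(t)=\int_0^t\bar\Lambda_r(\bar N(s))ds$ with $\bar\Lambda_r(n)=\Lambda_r(n)$ if $n_r>0$ and $\bar\Lambda_r(n)=\rho_r$ if $n_r=0$; for $\ell\in\mathcal L^*$, $\bar W_\ell(t)=\sum_{r\ni\ell}\nu_r\bar N_r(t)$ and $\bar Y_\ell(t)=\sum_{r\ni\ell}(\rho_rt-\bar D_r(t))$, so $\bar W(t)=\bar W(0)+\bar Y(t)$; and each $\bar Y_\ell$ is non-decreasing in $t\ge0$.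
   Formalization: Fluid limits are taken only at sample points and along subsequences where the scaled arrival and service counting processes obey the functional law of large numbers; convergence of the means alone does not give the stated fluid equations. The type of the sample space is fixed before the time T. *)

theory Defs
  imports "HOL-Probability.Probability"
begin

(* Links and job classes are the elements of finite types 'l and 'r, and "route r" is the set of
   links used by class r.  Vectors indexed by classes or links are functions. *)

definition offered_load :: "('r \<Rightarrow> real) \<Rightarrow> ('r \<Rightarrow> real) \<Rightarrow> 'r \<Rightarrow> real" where
  "offered_load lam \<nu> r = lam r * \<nu> r"

definition feasible :: "('r::finite \<Rightarrow> 'l set) \<Rightarrow> ('l \<Rightarrow> real) \<Rightarrow> ('r \<Rightarrow> real) set" where
  "feasible route c =
     {x. (\<forall>l. (\<Sum>r | l \<in> route r. x r) \<le> c l) \<and> (\<forall>r. 0 \<le> x r)}"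

definition bottleneck :: "('r::finite \<Rightarrow> 'l set) \<Rightarrow> ('l \<Rightarrow> real) \<Rightarrow> ('r \<Rightarrow> real) \<Rightarrow> 'l set" where
  "bottleneck route c \<rho> = {l. (\<Sum>r | l \<in> route r. \<rho> r) = c l}"

definition l1norm :: "('r::finite \<Rightarrow> real) \<Rightarrow> real" where
  "l1norm x = (\<Sum>r\<in>UNIV. \<bar>x r\<bar>)"

(* The derivative is two-sided; it is only ever taken at points x > 0. *)
definition partial2 :: "(real \<Rightarrow> real \<Rightarrow> real) \<Rightarrow> real \<Rightarrow> real \<Rightarrow> real" where
  "partial2 U n x = deriv (U n) x"

definition twice_differentiable_on :: "(real \<times> real \<Rightarrow> real) \<Rightarrow> (real \<times> real) set \<Rightarrow> bool" where
  "twice_differentiable_on f S \<longleftrightarrow>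
     (\<exists>g1 g2. \<forall>p\<in>S.
        (f has_derivative (\<lambda>h. g1 p * fst h + g2 p * snd h)) (at p within S) \<and>
        g1 differentiable (at p within S) \<and> g2 differentiable (at p within S))"

(* Twice differentiability is required in the open quadrant only; on the boundary it is replaced by
   continuity of U and of its second partial derivative.  Both follow from twice differentiability
   on the closed quadrant, which would however exclude functions such as
   U n x = n powr a * x powr (1 - a) / (1 - a) with 0 < a < 1. *)
definition utility_function :: "(real \<Rightarrow> real \<Rightarrow> real) \<Rightarrow> bool" where
  "utility_function U \<longleftrightarrow>
     twice_differentiable_on (\<lambda>(n, x). U n x) ({0<..} \<times> {0<..}) \<and>
     continuous_on ({0..} \<times> {0..}) (\<lambda>(n, x). U n x) \<and>
     continuous_on ({0..} \<times> {0<..}) (\<lambda>(n, x). partial2 U n x) \<and>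
     (\<forall>x\<ge>0. U 0 x = 0) \<and>
     (\<forall>n>0. strict_mono_on {0..} (U n)) \<and>
     (\<forall>n>0. \<forall>x\<ge>0. \<forall>y\<ge>0. \<forall>t. x \<noteq> y \<longrightarrow> 0 < t \<longrightarrow> t < 1 \<longrightarrow>
        (1 - t) * U n x + t * U n y < U n ((1 - t) * x + t * y)) \<and>
     (\<forall>x>0. strict_mono_on {0..} (\<lambda>n. partial2 U n x) \<and> partial2 U 0 x = 0 \<and>
        filterlim (\<lambda>n. partial2 U n x) at_top at_top)"

(* A component \<Lambda> n r with n r = 0 is an arbitrary but fixed choice among the maximizers. *)
definition utility_maximizing ::
  "('r::finite \<Rightarrow> 'l set) \<Rightarrow> ('l \<Rightarrow> real) \<Rightarrow> ('r \<Rightarrow> real \<Rightarrow> real \<Rightarrow> real)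
    \<Rightarrow> (('r \<Rightarrow> real) \<Rightarrow> 'r \<Rightarrow> real) \<Rightarrow> bool" where
  "utility_maximizing route c U \<Lambda> \<longleftrightarrow>
     (\<forall>n. (\<forall>r. 0 \<le> n r) \<longrightarrow>
        is_arg_max (\<lambda>x. \<Sum>r\<in>UNIV. U r (n r) (x r)) (\<lambda>x. x \<in> feasible route c) (\<Lambda> n))"

definition radially_homogeneous :: "(('r \<Rightarrow> real) \<Rightarrow> 'r \<Rightarrow> real) \<Rightarrow> bool" where
  "radially_homogeneous \<Lambda> \<longleftrightarrow>
     (\<forall>n a r. (\<forall>q. 0 \<le> n q) \<longrightarrow> 0 < a \<longrightarrow> 0 < n r \<longrightarrow> \<Lambda> (\<lambda>q. a * n q) r = \<Lambda> n r)"

definition class_cost ::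
  "('r \<Rightarrow> real) \<Rightarrow> ('r \<Rightarrow> real) \<Rightarrow> ('r \<Rightarrow> real \<Rightarrow> real \<Rightarrow> real) \<Rightarrow> 'r \<Rightarrow> real \<Rightarrow> real" where
  "class_cost lam \<nu> U r n =
     \<nu> r * integral {0..n} (\<lambda>q. partial2 (U r) q (offered_load lam \<nu> r))"

definition workload_feasible ::
  "('r::finite \<Rightarrow> 'l set) \<Rightarrow> 'l set \<Rightarrow> ('r \<Rightarrow> real) \<Rightarrow> ('l \<Rightarrow> real) \<Rightarrow> ('r \<Rightarrow> real) \<Rightarrow> bool" where
  "workload_feasible route Lb \<nu> w n \<longleftrightarrow>
     (\<forall>l\<in>Lb. w l \<le> (\<Sum>r | l \<in> route r. \<nu> r * n r)) \<and> (\<forall>r. 0 \<le> n r)"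

(* Only the values w l at bottleneck links l matter. *)
definition fixed_point ::
  "('r::finite \<Rightarrow> 'l set) \<Rightarrow> ('l \<Rightarrow> real) \<Rightarrow> ('r \<Rightarrow> real) \<Rightarrow> ('r \<Rightarrow> real)
    \<Rightarrow> ('r \<Rightarrow> real \<Rightarrow> real \<Rightarrow> real) \<Rightarrow> ('l \<Rightarrow> real) \<Rightarrow> 'r \<Rightarrow> real" where
  "fixed_point route c lam \<nu> U w =
     (THE n. is_arg_min (\<lambda>n. \<Sum>r\<in>UNIV. class_cost lam \<nu> U r (n r))
        (workload_feasible route (bottleneck route c (offered_load lam \<nu>)) \<nu> w) n)"

definition renewal_count :: "(nat \<Rightarrow> real) \<Rightarrow> real \<Rightarrow> nat" where
  "renewal_count x t = Max {i. (\<Sum>j=1..i. x j) \<le> t}"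

(* u k r i and v k r i (k, i \<ge> 1) are the interarrival times and service requirements of the k-th
   network.  The index (True, r, i) stands for u and (False, r, i) for v. *)
definition stochastic_primitives ::
  "'w measure \<Rightarrow> (nat \<Rightarrow> 'r \<Rightarrow> nat \<Rightarrow> 'w \<Rightarrow> real) \<Rightarrow> (nat \<Rightarrow> 'r \<Rightarrow> nat \<Rightarrow> 'w \<Rightarrow> real)
    \<Rightarrow> (nat \<Rightarrow> 'r \<Rightarrow> real) \<Rightarrow> (nat \<Rightarrow> 'r \<Rightarrow> real) \<Rightarrow> ('r \<Rightarrow> real) \<Rightarrow> ('r \<Rightarrow> real) \<Rightarrow> bool" where
  "stochastic_primitives P u v lamk \<nu>k lam \<nu> \<longleftrightarrow>
     prob_space P \<and>
     (\<forall>k\<ge>1. prob_space.indep_vars P (\<lambda>_. borel)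
        (\<lambda>(b, r, i). if b then u k r i else v k r i) (UNIV \<times> UNIV \<times> {1..})) \<and>
     (\<forall>k\<ge>1. \<forall>r. \<forall>i\<ge>1. \<forall>\<omega>\<in>space P. 0 \<le> u k r i \<omega> \<and> 0 \<le> v k r i \<omega>) \<and>
     (\<forall>k\<ge>1. \<forall>r. \<forall>i\<ge>2. distr P borel (u k r i) = distr P borel (u k r 2) \<and>
        distr P borel (v k r i) = distr P borel (v k r 2)) \<and>
     (\<forall>k\<ge>1. \<forall>r. 0 < lamk k r \<and> 0 < \<nu>k k r \<and>
        has_bochner_integral P (u k r 2) (1 / lamk k r) \<and>
        has_bochner_integral P (v k r 2) (\<nu>k k r)) \<and>
     (\<forall>r. (\<lambda>k. lamk k r) \<longlonglongrightarrow> lam r \<and> (\<lambda>k. \<nu>k k r) \<longlonglongrightarrow> \<nu> r) \<and>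
     (\<forall>r. AE \<omega> in P. (\<lambda>k. u k r 1 \<omega> / real k) \<longlonglongrightarrow> 0 \<and> (\<lambda>k. v k r 1 \<omega> / real k) \<longlonglongrightarrow> 0)"

(* One sample path of a network, driven by the interarrival times a and service requirements b. *)
definition network_path ::
  "('r::finite \<Rightarrow> 'l set) \<Rightarrow> 'l set \<Rightarrow> ('r \<Rightarrow> real) \<Rightarrow> (('r \<Rightarrow> real) \<Rightarrow> 'r \<Rightarrow> real) \<Rightarrow> ('r \<Rightarrow> real)
    \<Rightarrow> ('r \<Rightarrow> nat \<Rightarrow> real) \<Rightarrow> ('r \<Rightarrow> nat \<Rightarrow> real)
    \<Rightarrow> (real \<Rightarrow> 'r \<Rightarrow> nat) \<Rightarrow> (real \<Rightarrow> 'r \<Rightarrow> real) \<Rightarrow> (real \<Rightarrow> 'l \<Rightarrow> real) \<Rightarrow> (real \<Rightarrow> 'l \<Rightarrow> real)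
    \<Rightarrow> bool" where
  "network_path route Lb \<rho> \<Lambda> \<nu>k a b N D W Y \<longleftrightarrow>
     (\<forall>t\<ge>0. \<forall>r.
        real (N t r) =
          real (N 0 r) + real (renewal_count (a r) t) - real (renewal_count (b r) (D t r)) \<and>
        ((\<lambda>s. \<Lambda> (\<lambda>q. real (N s q)) r * of_bool (0 < N s r)) has_integral D t r) {0..t}) \<and>
     (\<forall>t\<ge>0. \<forall>l\<in>Lb.
        W t l = (\<Sum>r | l \<in> route r. \<nu>k r * real (N t r)) \<and>
        Y t l = (\<Sum>r | l \<in> route r. \<rho> r * t - D t r))"

definition scaled_limit :: "(nat \<Rightarrow> nat) \<Rightarrow> (nat \<Rightarrow> real \<Rightarrow> real) \<Rightarrow> (real \<Rightarrow> real) \<Rightarrow> bool" where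
  "scaled_limit \<sigma> X x \<longleftrightarrow>
     (\<forall>T. uniform_limit {0..T} (\<lambda>j t. X (\<sigma> j) (real (\<sigma> j) * t) / real (\<sigma> j)) x sequentially)"

(* u and v are the realized primitives at one sample point.  Fluid limits are taken at sample points
   (and along subsequences) at which the scaled arrival and service counting processes obey the
   functional law of large numbers; convergence of the means alone does not entail it. *)
definition fluid_limit ::
  "('r::finite \<Rightarrow> 'l set) \<Rightarrow> ('l \<Rightarrow> real) \<Rightarrow> ('r \<Rightarrow> real) \<Rightarrow> ('r \<Rightarrow> real)
    \<Rightarrow> (('r \<Rightarrow> real) \<Rightarrow> 'r \<Rightarrow> real) \<Rightarrow> (nat \<Rightarrow> 'r \<Rightarrow> real)
    \<Rightarrow> (nat \<Rightarrow> 'r \<Rightarrow> nat \<Rightarrow> real) \<Rightarrow> (nat \<Rightarrow> 'r \<Rightarrow> nat \<Rightarrow> real)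
    \<Rightarrow> (real \<Rightarrow> 'r \<Rightarrow> real) \<Rightarrow> (real \<Rightarrow> 'r \<Rightarrow> real) \<Rightarrow> (real \<Rightarrow> 'l \<Rightarrow> real) \<Rightarrow> (real \<Rightarrow> 'l \<Rightarrow> real)
    \<Rightarrow> bool" where
  "fluid_limit route c lam \<nu> \<Lambda> \<nu>k u v N D W Y \<longleftrightarrow>
     (let \<rho> = offered_load lam \<nu>; Lb = bottleneck route c \<rho> in
      \<exists>\<sigma> Nk Dk Wk Yk.
        strict_mono \<sigma> \<and>
        (\<forall>k\<ge>1. network_path route Lb \<rho> \<Lambda> (\<nu>k k) (u k) (v k) (Nk k) (Dk k) (Wk k) (Yk k)) \<and>
        (\<forall>r. scaled_limit \<sigma> (\<lambda>k t. real (renewal_count (u k r) t)) (\<lambda>t. lam r * t)) \<and>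
        (\<forall>r. scaled_limit \<sigma> (\<lambda>k y. real (renewal_count (v k r) y)) (\<lambda>y. y / \<nu> r)) \<and>
        (\<forall>r. scaled_limit \<sigma> (\<lambda>k t. real (Nk k t r)) (\<lambda>t. N t r)) \<and>
        (\<forall>r. scaled_limit \<sigma> (\<lambda>k t. Dk k t r) (\<lambda>t. D t r)) \<and>
        (\<forall>l\<in>Lb. scaled_limit \<sigma> (\<lambda>k t. Wk k t l) (\<lambda>t. W t l)) \<and>
        (\<forall>l\<in>Lb. scaled_limit \<sigma> (\<lambda>k t. Yk k t l) (\<lambda>t. Y t l)))"

end

theory Submission
  imports Defs
begin

text \<open>
  The total cost \<open>C(n) = \<Sum>\<^sub>r C\<^sub>r(n\<^sub>r)\<close> is a Lyapunov function. Write \<open>\<phi>\<^sub>r(q)\<close> for the marginal utility of class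
  \<open>r\<close> at its offered load \<open>\<rho>\<^sub>r\<close>, so that \<open>C\<^sub>r' = \<nu>\<^sub>r \<phi>\<^sub>r\<close>. Along a fluid limit \<open>N\<close> the cost has the derivative
  \<open>- g(N(t))\<close>, where the dissipation \<open>g(n) = \<Sum>\<^sub>r \<phi>\<^sub>r(n\<^sub>r) (\<Lambda>\<^sub>r(n) - \<rho>\<^sub>r)\<close> bounds from above, by concavity of
  the utilities, the gain in utility of the optimal allocation \<open>\<Lambda>(n)\<close> over the feasible allocation \<open>\<rho>\<close>. Hence
  \<open>g \<ge> 0\<close>, and \<open>g(m) = 0\<close> forces \<open>\<rho>\<close> to be optimal for \<open>m\<close>. The derivative exists at every time, including
  the times at which some \<open>N\<^sub>r\<close> vanishes: there \<open>C\<^sub>r(N\<^sub>r)\<close> has derivative zero, because \<open>N\<^sub>r\<close> is Lipschitz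
  and \<open>C\<^sub>r'(0) = 0\<close> (\<open>total_cost_along_path\<close>).

  States with zero dissipation are fixed points, by a variational argument. If \<open>g(m) = 0\<close> and \<open>n\<close> has
  at least the workload of \<open>m\<close> on every bottleneck link, then shifting \<open>\<rho>\<close> a little in the direction
  \<open>- \<nu> (n - m)\<close> keeps it feasible; optimality of \<open>\<rho>\<close> makes the directional derivative nonpositive, which
  says that the linearization of \<open>C\<close> at \<open>m\<close> does not decrease towards \<open>n\<close>. Strict convexity of \<open>C\<close> gives
  \<open>C(m) < C(n)\<close> unless \<open>n = m\<close> (\<open>stationary_minimizes_cost\<close>).

  Uniformity comes from compactness. Since this minimizer is strict, a state \<open>m\<close> of bounded cost and small
  dissipation is close to every state \<open>n\<close> that has no larger cost and no smaller bottleneck workloads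
  (\<open>small_dissipation_traps\<close>); the required smallness \<open>\<gamma>\<close> depends on the distance and on the cost bound
  \<open>K\<close> only. Along a fluid limit the cost never increases and the workloads never decrease, so from the first moment with
  dissipation below \<open>\<gamma>\<close> the path stays close to its position at that moment. Such a moment occurs before
  time \<open>K / \<gamma> + 1\<close>, as otherwise the cost would become negative. Thus the path converges, at a rate that
  depends on \<open>K\<close> only, and its limit has zero dissipation (\<open>fluid_paths_uniformly_attracted\<close>).

  It remains to obtain from the scaled networks the four properties of fluid limits used here: nonnegativity,
  the Lipschitz property, the derivative of \<open>N\<^sub>r\<close> at times with \<open>N\<^sub>r > 0\<close>, and the monotonicity of the
  bottleneck workloads. They are passed to the limit in the locale \<open>fluid_scaling\<close>.
\<close>

section \<open>Utility functions\<close>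

lemma utility_has_derivative:
  assumes U: "utility_function U" and "0 \<le> n" "0 < x"
  shows "(U n has_real_derivative partial2 U n x) (at x)"
proof (cases "n = 0")
  case True
  have "((\<lambda>_. 0) has_real_derivative 0) (at x)" by simp
  then have "(U 0 has_real_derivative 0) (at x)"
    by (rule has_field_derivative_transform_within_open[where S = "{0<..}"])
      (use U \<open>0 < x\<close> in \<open>auto simp: utility_function_def\<close>)
  moreover have "partial2 U 0 x = 0"
    using U \<open>0 < x\<close> by (simp add: utility_function_def)
  ultimately show ?thesis using True by simp
next
  case False
  then have "0 < n" using \<open>0 \<le> n\<close> by simp
  define S :: "(real \<times> real) set" where "S = {0<..} \<times> {0<..}"
  have "open S" "(n, x) \<in> S"
    using \<open>0 < n\<close> \<open>0 < x\<close> by (auto simp: S_def intro: open_Times)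
  have "twice_differentiable_on (\<lambda>(n, x). U n x) S"
    using U unfolding utility_function_def S_def by (elim conjE)
  then obtain g1 g2 where "((\<lambda>(n, x). U n x) has_derivative
      (\<lambda>h. g1 (n, x) * fst h + g2 (n, x) * snd h)) (at (n, x) within S)"
    unfolding twice_differentiable_on_def using \<open>(n, x) \<in> S\<close> by (elim exE) (drule bspec, auto)
  then have outer: "((\<lambda>(n, x). U n x) has_derivative (\<lambda>h. g1 (n, x) * fst h + g2 (n, x) * snd h))
      (at (n, x))"
    using at_within_open[OF \<open>(n, x) \<in> S\<close> \<open>open S\<close>] by simp
  have inner: "((\<lambda>y. (n, y)) has_derivative (\<lambda>h. (0, h))) (at x)"
    by (auto intro!: derivative_eq_intros)
  have "(U n has_derivative (\<lambda>h. g2 (n, x) * h)) (at x)"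
    using has_derivative_compose[OF inner outer] by simp
  then have "(U n has_real_derivative g2 (n, x)) (at x)"
    by (simp add: has_field_derivative_def)
  then show ?thesis
    unfolding partial2_def by (metis DERIV_imp_deriv)
qed

lemma utility_le_tangent:
  assumes U: "utility_function U" and "0 \<le> n" "0 < x" "0 \<le> y"
  shows "U n y \<le> U n x + partial2 U n x * (y - x)"
proof (cases "n = 0 \<or> x = y")
  case True
  then show ?thesis using assms by (auto simp: utility_function_def)
next
  case False
  then have "0 < n" "x \<noteq> y" using \<open>0 \<le> n\<close> by auto
  \<comment> \<open>The excess of \<open>U n\<close> over the chord from \<open>x\<close> to \<open>y\<close>; by concavity it cannot decrease initially.\<close>
  define h where "h t = U n (x + t * (y - x)) - t * (U n y - U n x)" for t
  have deriv: "(h has_real_derivative partial2 U n x * (y - x) - (U n y - U n x)) (at 0)"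
    unfolding h_def
    using utility_has_derivative[OF U \<open>0 \<le> n\<close> \<open>0 < x\<close>]
    by (auto intro!: derivative_eq_intros DERIV_chain2[where f = "U n"])
  have above: "h 0 < h t" if "0 < t" "t < 1" for t
  proof -
    have "(1 - t) * U n x + t * U n y < U n ((1 - t) * x + t * y)"
      using U \<open>0 < n\<close> \<open>x \<noteq> y\<close> assms that by (simp add: utility_function_def)
    also have "(1 - t) * x + t * y = x + t * (y - x)" by (simp add: algebra_simps)
    finally show ?thesis by (simp add: h_def algebra_simps)
  qed
  have "\<not> partial2 U n x * (y - x) - (U n y - U n x) < 0"
  proof
    assume "partial2 U n x * (y - x) - (U n y - U n x) < 0"
    then obtain d where "d > 0" "\<And>t. 0 < t \<Longrightarrow> t < d \<Longrightarrow> h t < h 0"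
      using DERIV_neg_dec_right[OF deriv] by auto
    moreover have "0 < min d 1 / 2" "min d 1 / 2 < 1" "min d 1 / 2 < d"
      using \<open>d > 0\<close> by (auto simp: min_def)
    ultimately have "h (min d 1 / 2) < h 0" "h 0 < h (min d 1 / 2)"
      using above by blast+
    then show False by simp
  qed
  then show ?thesis by simp
qed

section \<open>Convergence of vectors indexed by a finite type\<close>

lemma bounded_vectors_convergent_subseq:
  fixes x :: "nat \<Rightarrow> 'r::finite \<Rightarrow> real"
  assumes "\<And>j r. \<bar>x j r\<bar> \<le> b"
  obtains s y where "strict_mono s" "\<And>r. (\<lambda>j. x (s j) r) \<longlonglongrightarrow> y r"
proof -
  define v :: "nat \<Rightarrow> real ^ 'r" where "v j = (\<chi> r. x j r)" for j
  have "norm (v j) \<le> (\<Sum>r\<in>(UNIV :: 'r set). b)" for j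
    unfolding v_def by (rule order_trans[OF norm_le_l1_cart sum_mono]) (simp add: assms)
  then have "bounded (range v)"
    by (auto simp: bounded_iff)
  then obtain l s where "strict_mono s" "(v \<circ> s) \<longlonglongrightarrow> l"
    using bounded_imp_convergent_subsequence[of v] by blast
  then have "(\<lambda>j. x (s j) r) \<longlonglongrightarrow> l $ r" for r
    using tendsto_vec_nth[of "v \<circ> s" l sequentially r] by (simp add: v_def o_def)
  then show thesis using that[of s "\<lambda>r. l $ r"] \<open>strict_mono s\<close> by blast
qed

lemma l1norm_tendsto_zero:
  assumes "\<And>r. ((\<lambda>j. x j r) \<longlongrightarrow> 0) F"
  shows "((\<lambda>j. l1norm (x j)) \<longlongrightarrow> 0) F"
  unfolding l1norm_def by (rule tendsto_null_sum) (rule tendsto_rabs_zero[OF assms])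

lemma abs_le_l1norm: "\<bar>x r\<bar> \<le> l1norm x"
  unfolding l1norm_def by (rule member_le_sum) auto

lemma l1norm_triangle: "l1norm (\<lambda>r. x r - z r) \<le> l1norm (\<lambda>r. x r - y r) + l1norm (\<lambda>r. y r - z r)"
  unfolding l1norm_def sum.distrib[symmetric] by (rule sum_mono) linarith

lemma l1norm_commute: "l1norm (\<lambda>r. x r - y r) = l1norm (\<lambda>r. y r - x r)"
  by (simp add: l1norm_def abs_minus_commute)

section \<open>Utility-maximizing allocations\<close>

locale utility_network =
  fixes route :: "'r::finite \<Rightarrow> 'l::finite set"
    and c :: "'l \<Rightarrow> real"
    and lam \<nu> :: "'r \<Rightarrow> real"
    and U :: "'r \<Rightarrow> real \<Rightarrow> real \<Rightarrow> real"
    and \<Lambda> :: "('r \<Rightarrow> real) \<Rightarrow> 'r \<Rightarrow> real"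
  assumes route_nonempty: "route r \<noteq> {}"
    and lam_pos: "0 < lam r"
    and \<nu>_pos: "0 < \<nu> r"
    and load_feasible: "offered_load lam \<nu> \<in> feasible route c"
    and utility: "utility_function (U r)"
    and maximizing: "utility_maximizing route c U \<Lambda>"
    and homogeneous: "radially_homogeneous \<Lambda>"
begin

abbreviation "\<rho> \<equiv> offered_load lam \<nu>"
abbreviation "bottlenecks \<equiv> bottleneck route c \<rho>"

text \<open>The marginal utility at the offered load, which is the derivative of the cost up to the factor \<open>\<nu> r\<close>.\<close>
definition \<phi> :: "'r \<Rightarrow> real \<Rightarrow> real" where
  "\<phi> r q = partial2 (U r) q (\<rho> r)"

text \<open>The rate at which the total cost decreases along fluid paths.\<close>
definition dissipation :: "('r \<Rightarrow> real) \<Rightarrow> real" where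
  "dissipation n = (\<Sum>r\<in>UNIV. \<phi> r (n r) * (\<Lambda> n r - \<rho> r))"

definition total_cost :: "('r \<Rightarrow> real) \<Rightarrow> real" where
  "total_cost n = (\<Sum>r\<in>UNIV. class_cost lam \<nu> U r (n r))"

definition workload :: "('r \<Rightarrow> real) \<Rightarrow> 'l \<Rightarrow> real" where
  "workload n l = (\<Sum>r | l \<in> route r. \<nu> r * n r)"

definition total_capacity :: real where
  "total_capacity = (\<Sum>l\<in>UNIV. c l)"

lemma \<rho>_pos: "0 < \<rho> r"
  using lam_pos \<nu>_pos by (simp add: offered_load_def)

lemma allocation_feasible: "(\<And>r. 0 \<le> n r) \<Longrightarrow> \<Lambda> n \<in> feasible route c"
  using maximizing by (simp add: utility_maximizing_def is_arg_max_def)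

lemma allocation_optimal:
  assumes "\<And>r. 0 \<le> n r" "x \<in> feasible route c"
  shows "(\<Sum>r\<in>UNIV. U r (n r) (x r)) \<le> (\<Sum>r\<in>UNIV. U r (n r) (\<Lambda> n r))"
  using maximizing assms by (auto simp: utility_maximizing_def is_arg_max_linorder)

lemma capacity_nonneg: "0 \<le> c l"
proof -
  have "0 \<le> (\<Sum>r | l \<in> route r. \<rho> r)"
    using load_feasible by (auto simp: feasible_def intro: sum_nonneg)
  also have "\<dots> \<le> c l"
    using load_feasible by (auto simp: feasible_def)
  finally show ?thesis .
qed

text \<open>The sum of all capacities is a crude bound, but it serves for all routes at once.\<close>
lemma feasible_le_total_capacity:
  assumes "x \<in> feasible route c"
  shows "x r \<le> total_capacity"
proof -
  obtain l where l: "l \<in> route r" using route_nonempty by blast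
  have "x r \<le> (\<Sum>q | l \<in> route q. x q)"
    using assms l by (intro member_le_sum) (auto simp: feasible_def)
  also have "\<dots> \<le> c l" using assms by (auto simp: feasible_def)
  also have "\<dots> \<le> total_capacity"
    unfolding total_capacity_def by (intro member_le_sum) (auto simp: capacity_nonneg)
  finally show ?thesis .
qed

lemma allocation_bounds:
  assumes "\<And>q. 0 \<le> n q"
  shows "0 \<le> \<Lambda> n r" "\<Lambda> n r \<le> total_capacity"
  using allocation_feasible[of n] feasible_le_total_capacity[of "\<Lambda> n" r] assms
  by (auto simp: feasible_def)

lemma total_capacity_nonneg: "0 \<le> total_capacity"
  by (simp add: total_capacity_def sum_nonneg capacity_nonneg)

text \<open>The midpoint of two optimal allocations that differ in a class with jobs would be strictly better.\<close>
lemma optimal_allocation_unique: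
  assumes n: "\<And>q. 0 \<le> n q" and x: "x \<in> feasible route c"
    and opt: "(\<Sum>q\<in>UNIV. U q (n q) (\<Lambda> n q)) \<le> (\<Sum>q\<in>UNIV. U q (n q) (x q))"
    and r: "0 < n r"
  shows "x r = \<Lambda> n r"
proof (rule ccontr)
  assume "x r \<noteq> \<Lambda> n r"
  define y where "y q = (1 - 1 / 2) * x q + 1 / 2 * \<Lambda> n q" for q
  note M = allocation_feasible[OF n]
  have nonneg: "0 \<le> x q" "0 \<le> \<Lambda> n q" for q
    using x M by (auto simp: feasible_def)
  have "y \<in> feasible route c"
  proof -
    have "(\<Sum>q | l \<in> route q. y q) \<le> c l" for l
    proof -
      have "(\<Sum>q | l \<in> route q. y q)
          = 1 / 2 * (\<Sum>q | l \<in> route q. x q) + 1 / 2 * (\<Sum>q | l \<in> route q. \<Lambda> n q)"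
        by (simp add: y_def sum.distrib sum_distrib_left)
      also have "\<dots> \<le> c l"
      proof -
        have "(\<Sum>q | l \<in> route q. x q) \<le> c l" "(\<Sum>q | l \<in> route q. \<Lambda> n q) \<le> c l"
          using x M by (auto simp: feasible_def)
        then show ?thesis by linarith
      qed
      finally show ?thesis .
    qed
    then show ?thesis using nonneg by (simp add: feasible_def y_def)
  qed
  have strict: "(1 - 1 / 2) * U q (n q) (x q) + 1 / 2 * U q (n q) (\<Lambda> n q) < U q (n q) (y q)"
    if "x q \<noteq> \<Lambda> n q" "0 < n q" for q
    using utility[of q] nonneg that unfolding y_def utility_function_def
    by (smt (verit, best) divide_less_eq_1_pos half_gt_zero_iff)
  have weak: "(1 - 1 / 2) * U q (n q) (x q) + 1 / 2 * U q (n q) (\<Lambda> n q) \<le> U q (n q) (y q)" for q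
  proof (cases "n q = 0")
    case True
    then show ?thesis using utility[of q] nonneg by (simp add: utility_function_def y_def)
  next
    case False
    then show ?thesis
      using strict[of q] n[of q] by (cases "x q = \<Lambda> n q") (auto simp: y_def less_imp_le)
  qed
  have "(\<Sum>q\<in>UNIV. (1 - 1 / 2) * U q (n q) (x q) + 1 / 2 * U q (n q) (\<Lambda> n q))
      < (\<Sum>q\<in>UNIV. U q (n q) (y q))"
    using strict[OF \<open>x r \<noteq> \<Lambda> n r\<close> r] weak by (intro sum_strict_mono_ex1) auto
  also have "\<dots> \<le> (\<Sum>q\<in>UNIV. U q (n q) (\<Lambda> n q))"
    by (rule allocation_optimal[OF n \<open>y \<in> _\<close>])
  finally have "1 / 2 * (\<Sum>q\<in>UNIV. U q (n q) (x q)) + 1 / 2 * (\<Sum>q\<in>UNIV. U q (n q) (\<Lambda> n q))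
      < (\<Sum>q\<in>UNIV. U q (n q) (\<Lambda> n q))"
    by (simp add: sum.distrib sum_distrib_left)
  then show False using opt by simp
qed

lemma feasible_limit:
  assumes "\<And>j. x j \<in> feasible route c" "\<And>r. (\<lambda>j. x j r) \<longlonglongrightarrow> y r"
  shows "y \<in> feasible route c"
proof -
  have "(\<Sum>r | l \<in> route r. y r) \<le> c l" for l
    by (rule LIMSEQ_le_const2[OF tendsto_sum[OF assms(2)]]) (use assms(1) in \<open>auto simp: feasible_def\<close>)
  moreover have "0 \<le> y r" for r
    by (rule LIMSEQ_le_const[OF assms(2)]) (use assms(1) in \<open>auto simp: feasible_def\<close>)
  ultimately show ?thesis by (simp add: feasible_def)
qed

lemma utility_sum_tendsto:
  assumes "\<And>r j. 0 \<le> n j r" "\<And>r. (\<lambda>j. n j r) \<longlonglongrightarrow> m r"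
    and "\<And>r j. 0 \<le> x j r" "\<And>r. (\<lambda>j. x j r) \<longlonglongrightarrow> y r"
  shows "(\<lambda>j. \<Sum>r\<in>UNIV. U r (n j r) (x j r)) \<longlonglongrightarrow> (\<Sum>r\<in>UNIV. U r (m r) (y r))"
proof (rule tendsto_sum)
  fix r
  have "0 \<le> m r" "0 \<le> y r"
    using assms(1,3) by (auto intro: LIMSEQ_le_const[OF assms(2)] LIMSEQ_le_const[OF assms(4)])
  moreover have "continuous_on ({0..} \<times> {0..}) (\<lambda>(n, x). U r n x)"
    using utility[of r] by (simp add: utility_function_def)
  moreover have "(\<lambda>j. (n j r, x j r)) \<longlonglongrightarrow> (m r, y r)"
    by (intro tendsto_Pair assms)
  ultimately show "(\<lambda>j. U r (n j r) (x j r)) \<longlonglongrightarrow> U r (m r) (y r)"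
    using continuous_on_tendsto_compose[of "{0..} \<times> {0..}" "\<lambda>(n, x). U r n x"
        "\<lambda>j. (n j r, x j r)" "(m r, y r)" sequentially] assms(1,3)
    by simp
qed

text \<open>The allocation of a class without jobs is not determined by optimality, hence the restriction to \<open>0 < m r\<close>.
  Any limit point of allocations along states tending to \<open>m\<close> is again optimal for \<open>m\<close>, and on such
  components the optimum is unique.\<close>
lemma allocation_continuous:
  assumes m: "\<And>q. 0 \<le> m q" and r: "0 < m r" and \<eta>: "0 < \<eta>"
  shows "\<exists>\<delta>>0. \<forall>n. (\<forall>q. 0 \<le> n q) \<longrightarrow> (\<forall>q. \<bar>n q - m q\<bar> < \<delta>) \<longrightarrow> \<bar>\<Lambda> n r - \<Lambda> m r\<bar> < \<eta>"
proof (rule ccontr)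
  assume "\<not> ?thesis"
  then have "\<exists>n. (\<forall>q. 0 \<le> n q) \<and> (\<forall>q. \<bar>n q - m q\<bar> < \<delta>) \<and> \<eta> \<le> \<bar>\<Lambda> n r - \<Lambda> m r\<bar>" if "0 < \<delta>" for \<delta>
    using that by (meson not_less)
  then have "\<exists>n. (\<forall>q. 0 \<le> n q) \<and> (\<forall>q. \<bar>n q - m q\<bar> < inverse (real (Suc j))) \<and>
      \<eta> \<le> \<bar>\<Lambda> n r - \<Lambda> m r\<bar>" for j
    by simp
  then obtain n where n: "\<And>j q. 0 \<le> n j q"
    and close: "\<And>j q. \<bar>n j q - m q\<bar> < inverse (real (Suc j))"
    and far: "\<And>j. \<eta> \<le> \<bar>\<Lambda> (n j) r - \<Lambda> m r\<bar>"
    by metis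
  have lim: "(\<lambda>j. n j q) \<longlonglongrightarrow> m q" for q
  proof (rule LIM_zero_cancel, rule Lim_null_comparison)
    show "\<forall>\<^sub>F j in sequentially. norm (n j q - m q) \<le> inverse (real (Suc j))"
      using close by (simp add: less_imp_le)
    show "(\<lambda>j. inverse (real (Suc j))) \<longlonglongrightarrow> 0"
      by (rule LIMSEQ_inverse_real_of_nat)
  qed
  obtain s y where s: "strict_mono s" and y: "\<And>q. (\<lambda>j. \<Lambda> (n (s j)) q) \<longlonglongrightarrow> y q"
    by (rule bounded_vectors_convergent_subseq[of "\<lambda>j. \<Lambda> (n j)" total_capacity])
      (use allocation_bounds[OF n] in \<open>auto simp: abs_le_iff intro: order_trans[of _ 0]\<close>)
  have lim_s: "(\<lambda>j. n (s j) q) \<longlonglongrightarrow> m q" for q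
    using LIMSEQ_subseq_LIMSEQ[OF lim s] by (simp add: o_def)
  have "y \<in> feasible route c"
    by (rule feasible_limit[OF allocation_feasible[OF n] y])
  moreover have "(\<Sum>q\<in>UNIV. U q (m q) (\<Lambda> m q)) \<le> (\<Sum>q\<in>UNIV. U q (m q) (y q))"
  proof (rule LIMSEQ_le)
    show "(\<lambda>j. \<Sum>q\<in>UNIV. U q (n (s j) q) (\<Lambda> m q)) \<longlonglongrightarrow> (\<Sum>q\<in>UNIV. U q (m q) (\<Lambda> m q))"
      by (rule utility_sum_tendsto) (use n lim_s allocation_bounds[OF m] in auto)
    show "(\<lambda>j. \<Sum>q\<in>UNIV. U q (n (s j) q) (\<Lambda> (n (s j)) q)) \<longlonglongrightarrow> (\<Sum>q\<in>UNIV. U q (m q) (y q))"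
      by (rule utility_sum_tendsto) (use n lim_s y allocation_bounds[OF n] in auto)
    show "\<exists>N. \<forall>j\<ge>N. (\<Sum>q\<in>UNIV. U q (n (s j) q) (\<Lambda> m q))
        \<le> (\<Sum>q\<in>UNIV. U q (n (s j) q) (\<Lambda> (n (s j)) q))"
      by (intro exI allI impI allocation_optimal allocation_feasible n m)
  qed
  ultimately have "y r = \<Lambda> m r"
    using m r by (intro optimal_allocation_unique)
  then have "(\<lambda>j. \<bar>\<Lambda> (n (s j)) r - \<Lambda> m r\<bar>) \<longlonglongrightarrow> 0"
    using y[of r] by (intro tendsto_rabs_zero LIM_zero) simp
  then have "\<eta> \<le> 0"
    by (rule LIMSEQ_le_const) (use far in auto)
  then show False using \<eta> by simp
qed

section \<open>Costs\<close>

lemma \<phi>_zero: "\<phi> r 0 = 0"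
  using utility[of r] \<rho>_pos[of r] by (simp add: \<phi>_def utility_function_def)

lemma \<phi>_strict_mono: "0 \<le> p \<Longrightarrow> p < q \<Longrightarrow> \<phi> r p < \<phi> r q"
  using utility[of r] \<rho>_pos[of r] by (simp add: \<phi>_def utility_function_def strict_mono_on_def)

lemma \<phi>_continuous: "continuous_on {0..} (\<phi> r)"
proof -
  have "continuous_on ({0..} \<times> {0<..}) (\<lambda>(n, x). partial2 (U r) n x)"
    using utility[of r] by (simp add: utility_function_def)
  then have "continuous_on {0..} ((\<lambda>(n, x). partial2 (U r) n x) \<circ> (\<lambda>n. (n, \<rho> r)))"
    by (intro continuous_on_compose continuous_intros)
      (rule continuous_on_subset, use \<rho>_pos[of r] in auto)
  then show ?thesis by (simp add: o_def \<phi>_def[abs_def])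
qed

lemma class_cost_has_derivative:
  assumes "0 \<le> n"
  shows "(class_cost lam \<nu> U r has_real_derivative \<nu> r * \<phi> r n) (at n within {0..})"
proof -
  have "((\<lambda>x. integral {0..x} (\<phi> r)) has_real_derivative \<phi> r n) (at n within {0..n + 1})"
    by (rule integral_has_real_derivative)
      (use assms continuous_on_subset[OF \<phi>_continuous] in auto)
  moreover have "at n within {0..n + 1} = at n within {0..}"
    by (rule at_within_nhd[where S = "{..<n + 1}"]) auto
  ultimately have "((\<lambda>x. \<nu> r * integral {0..x} (\<phi> r)) has_real_derivative \<nu> r * \<phi> r n)
      (at n within {0..})"
    by (simp add: DERIV_cmult)
  then show ?thesis
    by (simp add: class_cost_def[abs_def] \<phi>_def[abs_def])
qed

text \<open>The cost is strictly convex because its derivative \<open>\<nu> r * \<phi> r\<close> is strictly increasing.\<close>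
lemma class_cost_gt_tangent:
  assumes "0 \<le> n" "0 \<le> m" "n \<noteq> m"
  shows "class_cost lam \<nu> U r m + \<nu> r * \<phi> r m * (n - m) < class_cost lam \<nu> U r n"
proof -
  have mvt: "\<exists>z\<in>{a<..<b}. class_cost lam \<nu> U r b - class_cost lam \<nu> U r a = \<nu> r * \<phi> r z * (b - a)"
    if "0 \<le> a" "a < b" for a b
    by (rule mvt_simple[OF \<open>a < b\<close> has_derivative_subset
          [OF class_cost_has_derivative[unfolded has_field_derivative_def]]])
      (use that in auto)
  show ?thesis
  proof (cases "m < n")
    case True
    then obtain z where "z \<in> {m<..<n}"
      and "class_cost lam \<nu> U r n - class_cost lam \<nu> U r m = \<nu> r * \<phi> r z * (n - m)"
      using mvt[of m n] assms by auto
    moreover from this have "\<nu> r * \<phi> r m * (n - m) < \<nu> r * \<phi> r z * (n - m)"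
      using \<phi>_strict_mono[of m z r] assms \<nu>_pos[of r] True by simp
    ultimately show ?thesis by simp
  next
    case False
    then have "n < m" using assms by simp
    then obtain z where "z \<in> {n<..<m}"
      and "class_cost lam \<nu> U r m - class_cost lam \<nu> U r n = \<nu> r * \<phi> r z * (m - n)"
      using mvt[of n m] assms by auto
    moreover from this have "\<nu> r * \<phi> r z * (m - n) < \<nu> r * \<phi> r m * (m - n)"
      using \<phi>_strict_mono[of z m r] assms \<nu>_pos[of r] \<open>n < m\<close> by simp
    ultimately show ?thesis by (simp add: algebra_simps)
  qed
qed

lemma class_cost_ge_tangent:
  assumes "0 \<le> n" "0 \<le> m"
  shows "class_cost lam \<nu> U r m + \<nu> r * \<phi> r m * (n - m) \<le> class_cost lam \<nu> U r n"
  using class_cost_gt_tangent[OF assms, of r] by (cases "n = m") auto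

lemma \<phi>_nonneg: "0 \<le> q \<Longrightarrow> 0 \<le> \<phi> r q"
  using \<phi>_strict_mono[of 0 q r] \<phi>_zero[of r] by (cases "q = 0") auto

lemma class_cost_mono:
  assumes "0 \<le> m" "m \<le> n"
  shows "class_cost lam \<nu> U r m \<le> class_cost lam \<nu> U r n"
proof -
  have "0 \<le> \<nu> r * \<phi> r m * (n - m)"
    using assms \<phi>_nonneg[of m r] \<nu>_pos[of r] by simp
  then show ?thesis
    using class_cost_ge_tangent[of n m r] assms by simp
qed

lemma class_cost_zero: "class_cost lam \<nu> U r 0 = 0"
  by (simp add: class_cost_def)

lemma class_cost_nonneg: "0 \<le> n \<Longrightarrow> 0 \<le> class_cost lam \<nu> U r n"
  using class_cost_mono[of 0 n r] by (simp add: class_cost_zero)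

lemma total_cost_nonneg: "(\<And>r. 0 \<le> n r) \<Longrightarrow> 0 \<le> total_cost n"
  by (simp add: total_cost_def sum_nonneg class_cost_nonneg)

text \<open>The cost lies above its tangent at 1, whose slope is positive, so it grows at least linearly.\<close>
lemma sublevel_bounded:
  obtains b where "\<And>n r. (\<And>q. 0 \<le> n q) \<Longrightarrow> total_cost n \<le> K \<Longrightarrow> n r \<le> b"
proof -
  \<comment> \<open>The tangent is taken at 1 because the one at 0 is horizontal.\<close>
  define slope where "slope r = \<nu> r * \<phi> r 1" for r
  have slope_pos: "0 < slope r" for r
    using \<phi>_strict_mono[of 0 1 r] \<phi>_zero[of r] \<nu>_pos[of r] by (simp add: slope_def)
  have bound: "n r \<le> (\<Sum>q\<in>UNIV. \<bar>1 + K / slope q\<bar>)"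
    if n: "\<And>q. 0 \<le> n q" and K: "total_cost n \<le> K" for n r
  proof -
    have "slope r * (n r - 1) \<le> class_cost lam \<nu> U r (n r)"
      using class_cost_ge_tangent[of "n r" 1 r] class_cost_nonneg[of 1 r] n[of r]
      by (simp add: slope_def)
    also have "\<dots> \<le> total_cost n"
      unfolding total_cost_def
      using n class_cost_nonneg
      by (intro member_le_sum[where f = "\<lambda>r. class_cost lam \<nu> U r (n r)"]) auto
    finally have "n r \<le> 1 + K / slope r"
      using K slope_pos[of r] by (simp add: field_simps)
    also have "\<dots> \<le> \<bar>1 + K / slope r\<bar>" by simp
    also have "\<dots> \<le> (\<Sum>q\<in>UNIV. \<bar>1 + K / slope q\<bar>)"
      by (rule member_le_sum[where f = "\<lambda>q. \<bar>1 + K / slope q\<bar>"]) auto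
    finally show ?thesis .
  qed
  show thesis by (rule that[of "\<Sum>q\<in>UNIV. \<bar>1 + K / slope q\<bar>"]) (rule bound)
qed

lemma total_cost_tendsto:
  assumes "\<And>r. 0 \<le> m r" "\<And>j r. 0 \<le> n j r" "\<And>r. ((\<lambda>j. n j r) \<longlongrightarrow> m r) F"
  shows "((\<lambda>j. total_cost (n j)) \<longlongrightarrow> total_cost m) F"
  unfolding total_cost_def
proof (rule tendsto_sum)
  fix r
  have "continuous_on {0..} (class_cost lam \<nu> U r)"
    by (rule DERIV_continuous_on[of _ _ "\<lambda>n. \<nu> r * \<phi> r n"]) (simp add: class_cost_has_derivative)
  then show "((\<lambda>j. class_cost lam \<nu> U r (n j r)) \<longlongrightarrow> class_cost lam \<nu> U r (m r)) F"
    by (rule continuous_on_tendsto_compose) (use assms in auto)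
qed

lemma workload_tendsto:
  assumes "\<And>r. ((\<lambda>j. n j r) \<longlongrightarrow> m r) F"
  shows "((\<lambda>j. workload (n j) l) \<longlongrightarrow> workload m l) F"
  unfolding workload_def by (intro tendsto_intros assms)

section \<open>Dissipation\<close>

text \<open>Each utility lies below its tangent at the offered load.\<close>
lemma utility_gain_le_dissipation:
  assumes n: "\<And>r. 0 \<le> n r"
  shows "(\<Sum>r\<in>UNIV. U r (n r) (\<Lambda> n r)) - (\<Sum>r\<in>UNIV. U r (n r) (\<rho> r)) \<le> dissipation n"
proof -
  have "(\<Sum>r\<in>UNIV. U r (n r) (\<Lambda> n r))
      \<le> (\<Sum>r\<in>UNIV. U r (n r) (\<rho> r) + \<phi> r (n r) * (\<Lambda> n r - \<rho> r))"
    unfolding \<phi>_def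
    by (intro sum_mono utility_le_tangent utility n \<rho>_pos allocation_bounds)
  then show ?thesis by (simp add: dissipation_def sum.distrib)
qed

lemma dissipation_nonneg: "(\<And>r. 0 \<le> n r) \<Longrightarrow> 0 \<le> dissipation n"
  using utility_gain_le_dissipation[of n] allocation_optimal[of n, OF _ load_feasible] by force

text \<open>Although \<open>\<Lambda> n r\<close> may jump as \<open>n r\<close> tends to 0, the factor \<open>\<phi> r (n r)\<close> vanishes there and removes the
  discontinuity.\<close>
lemma dissipation_tendsto:
  assumes m: "\<And>r. 0 \<le> m r" and n: "\<And>j r. 0 \<le> n j r"
    and lim: "\<And>r. ((\<lambda>j. n j r) \<longlongrightarrow> m r) F"
  shows "((\<lambda>j. dissipation (n j)) \<longlongrightarrow> dissipation m) F"
  unfolding dissipation_def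
proof (rule tendsto_sum)
  fix r
  have \<phi>_lim: "((\<lambda>j. \<phi> r (n j r)) \<longlongrightarrow> \<phi> r (m r)) F"
    by (rule continuous_on_tendsto_compose[OF \<phi>_continuous lim]) (use m n in auto)
  show "((\<lambda>j. \<phi> r (n j r) * (\<Lambda> (n j) r - \<rho> r)) \<longlongrightarrow> \<phi> r (m r) * (\<Lambda> m r - \<rho> r)) F"
  proof (cases "m r = 0")
    case True
    have "\<bar>\<Lambda> (n j) r - \<rho> r\<bar> \<le> total_capacity + \<rho> r" for j
      using allocation_bounds[of "n j" r] n \<rho>_pos[of r] by force
    then have "((\<lambda>j. \<phi> r (n j r) * (\<Lambda> (n j) r - \<rho> r)) \<longlongrightarrow> 0) F"
      using \<phi>_lim True
      by (intro lim_null_mult_right_bounded[where B = "total_capacity + \<rho> r"]) (auto simp: \<phi>_zero)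
    then show ?thesis using True by (simp add: \<phi>_zero)
  next
    case False
    have "((\<lambda>j. \<Lambda> (n j) r) \<longlongrightarrow> \<Lambda> m r) F"
    proof (rule tendstoI)
      fix \<eta> :: real assume "0 < \<eta>"
      then obtain \<delta> where "0 < \<delta>" and \<delta>: "\<And>x. (\<And>q. 0 \<le> x q) \<Longrightarrow> (\<And>q. \<bar>x q - m q\<bar> < \<delta>)
          \<Longrightarrow> \<bar>\<Lambda> x r - \<Lambda> m r\<bar> < \<eta>"
        using allocation_continuous[of m r \<eta>] m False by (metis less_eq_real_def)
      have "\<forall>\<^sub>F j in F. \<forall>q. \<bar>n j q - m q\<bar> < \<delta>"
        using tendstoD[OF lim \<open>0 < \<delta>\<close>] by (intro eventually_all_finite) (simp add: dist_real_def)
      then show "\<forall>\<^sub>F j in F. dist (\<Lambda> (n j) r) (\<Lambda> m r) < \<eta>"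
        by (rule eventually_mono) (simp add: dist_real_def \<delta> n)
    qed
    then show ?thesis by (intro tendsto_intros \<phi>_lim)
  qed
qed

text \<open>Without dissipation the offered load is itself an optimal allocation. Giving class \<open>r\<close> the extra
  allocation \<open>- \<theta> * \<nu> r * (n r - m r)\<close> changes the load of a bottleneck link \<open>l\<close> by \<open>- \<theta>\<close> times
  \<open>workload n l - workload m l\<close>, which is not positive, and all other constraints have slack at the offered
  load. So this direction is feasible, and by optimality the utility does not increase along it.\<close>
lemma load_optimal_directional:
  assumes m: "\<And>r. 0 \<le> m r" and "dissipation m = 0"
    and n: "\<And>l. l \<in> bottlenecks \<Longrightarrow> workload m l \<le> workload n l"
  shows "0 \<le> (\<Sum>r\<in>UNIV. \<phi> r (m r) * (\<nu> r * (n r - m r)))"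
proof -
  define d where "d r = - (\<nu> r * (n r - m r))" for r
  define F where "F \<theta> = (\<Sum>r\<in>UNIV. U r (m r) (\<rho> r + \<theta> * d r))" for \<theta>
  have deriv: "(F has_real_derivative (\<Sum>r\<in>UNIV. \<phi> r (m r) * d r)) (at 0)"
    unfolding F_def
  proof (rule DERIV_sum)
    fix r
    show "((\<lambda>\<theta>. U r (m r) (\<rho> r + \<theta> * d r)) has_real_derivative \<phi> r (m r) * d r) (at 0)"
      using utility_has_derivative[OF utility m \<rho>_pos, of r]
      by (auto intro!: derivative_eq_intros DERIV_chain2[where f = "U r (m r)"] simp: \<phi>_def)
  qed
  have "\<forall>\<^sub>F \<theta> in at_right 0. (\<lambda>r. \<rho> r + \<theta> * d r) \<in> feasible route c"
  proof -
    have "\<forall>\<^sub>F \<theta> in at_right 0. 0 < \<rho> r + \<theta> * d r" for r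
    proof (rule order_tendstoD)
      show "((\<lambda>\<theta>. \<rho> r + \<theta> * d r) \<longlongrightarrow> \<rho> r + 0 * d r) (at_right 0)"
        by (intro tendsto_intros)
    qed (simp add: \<rho>_pos)
    then have pos: "\<forall>\<^sub>F \<theta> in at_right 0. \<forall>r. 0 < \<rho> r + \<theta> * d r"
      by (rule eventually_all_finite)
    have "\<forall>\<^sub>F \<theta> in at_right 0. (\<Sum>r | l \<in> route r. \<rho> r + \<theta> * d r) \<le> c l" for l
    proof (cases "l \<in> bottlenecks")
      case True
      have "(\<Sum>r | l \<in> route r. d r) = workload m l - workload n l"
        by (simp add: d_def workload_def sum_subtractf[symmetric] algebra_simps)
      then have "(\<Sum>r | l \<in> route r. d r) \<le> 0"
        using n[OF True] by simp
      then have "(\<Sum>r | l \<in> route r. \<rho> r + \<theta> * d r) \<le> c l" if "0 < \<theta>" for \<theta>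
        using True that by (simp add: bottleneck_def sum.distrib sum_distrib_left[symmetric]
            mult_nonneg_nonpos)
      then show ?thesis
        by (auto simp: eventually_at_filter)
    next
      case False
      have "\<forall>\<^sub>F \<theta> in at_right 0. (\<Sum>r | l \<in> route r. \<rho> r + \<theta> * d r) < c l"
      proof (rule order_tendstoD)
        show "((\<lambda>\<theta>. \<Sum>r | l \<in> route r. \<rho> r + \<theta> * d r)
            \<longlongrightarrow> (\<Sum>r | l \<in> route r. \<rho> r + 0 * d r)) (at_right 0)"
          by (intro tendsto_intros)
        have "(\<Sum>r | l \<in> route r. \<rho> r) \<le> c l"
          using load_feasible by (simp add: feasible_def)
        then show "(\<Sum>r | l \<in> route r. \<rho> r + 0 * d r) < c l"
          using False by (simp add: bottleneck_def)
      qed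
      then show ?thesis by (rule eventually_mono) simp
    qed
    then have "\<forall>\<^sub>F \<theta> in at_right 0. \<forall>l. (\<Sum>r | l \<in> route r. \<rho> r + \<theta> * d r) \<le> c l"
      by (rule eventually_all_finite)
    with pos show ?thesis
      by eventually_elim (auto simp: feasible_def intro: less_imp_le)
  qed
  then have "\<forall>\<^sub>F \<theta> in at_right 0. F \<theta> \<le> F 0"
  proof (rule eventually_mono)
    fix \<theta> assume x: "(\<lambda>r. \<rho> r + \<theta> * d r) \<in> feasible route c"
    have "F \<theta> \<le> (\<Sum>r\<in>UNIV. U r (m r) (\<Lambda> m r))"
      unfolding F_def by (rule allocation_optimal[OF m x])
    also have "\<dots> \<le> F 0"
      using utility_gain_le_dissipation[of m] m \<open>dissipation m = 0\<close> by (simp add: F_def)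
    finally show "F \<theta> \<le> F 0" .
  qed
  then obtain b where b: "b > 0" "\<And>\<theta>. 0 < \<theta> \<Longrightarrow> \<theta> < b \<Longrightarrow> F \<theta> \<le> F 0"
    by (auto simp: eventually_at_right_field)
  have "\<not> 0 < (\<Sum>r\<in>UNIV. \<phi> r (m r) * d r)"
  proof
    assume "0 < (\<Sum>r\<in>UNIV. \<phi> r (m r) * d r)"
    then obtain e where "e > 0" "\<And>\<theta>. 0 < \<theta> \<Longrightarrow> \<theta> < e \<Longrightarrow> F 0 < F \<theta>"
      using DERIV_pos_inc_right[OF deriv] by auto
    moreover have "0 < min b e / 2" "min b e / 2 < b" "min b e / 2 < e"
      using b \<open>e > 0\<close> by (auto simp: min_def)
    ultimately show False using b by (meson not_less)
  qed
  then show ?thesis by (simp add: d_def sum_negf)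
qed

text \<open>The directional inequality says that the linearization of the cost at \<open>m\<close> does not decrease towards
  \<open>n\<close>, and strict convexity turns this into a strict inequality.\<close>
lemma stationary_minimizes_cost:
  assumes m: "\<And>r. 0 \<le> m r" and "dissipation m = 0"
    and n: "\<And>r. 0 \<le> n r" "\<And>l. l \<in> bottlenecks \<Longrightarrow> workload m l \<le> workload n l" "n \<noteq> m"
  shows "total_cost m < total_cost n"
proof -
  obtain r where "n r \<noteq> m r" using \<open>n \<noteq> m\<close> by blast
  have "total_cost m \<le> total_cost m + (\<Sum>r\<in>UNIV. \<phi> r (m r) * (\<nu> r * (n r - m r)))"
    using load_optimal_directional[OF assms(1,2,4)] by simp
  also have "\<dots> = (\<Sum>r\<in>UNIV. class_cost lam \<nu> U r (m r) + \<nu> r * \<phi> r (m r) * (n r - m r))"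
    by (simp add: total_cost_def sum.distrib mult_ac)
  also have "\<dots> < total_cost n"
    unfolding total_cost_def
    using class_cost_gt_tangent[OF n(1) m \<open>n r \<noteq> m r\<close>] class_cost_ge_tangent[OF n(1) m]
    by (intro sum_strict_mono_ex1) auto
  finally show ?thesis .
qed

lemma stationary_eq_fixed_point:
  assumes m: "\<And>r. 0 \<le> m r" and "dissipation m = 0"
  shows "fixed_point route c lam \<nu> U (workload m) = m"
proof -
  have "is_arg_min (\<lambda>n. \<Sum>r\<in>UNIV. class_cost lam \<nu> U r (n r))
      (workload_feasible route bottlenecks \<nu> (workload m)) x \<longleftrightarrow> x = m" for x
  proof
    have feas: "workload_feasible route bottlenecks \<nu> (workload m) n \<longleftrightarrow>
        (\<forall>l\<in>bottlenecks. workload m l \<le> workload n l) \<and> (\<forall>r. 0 \<le> n r)" for n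
      by (simp add: workload_feasible_def workload_def)
    have least: "total_cost m < total_cost n"
      if "workload_feasible route bottlenecks \<nu> (workload m) n" "n \<noteq> m" for n
      using that stationary_minimizes_cost[OF assms] by (simp add: feas)
    show "x = m" if "is_arg_min (\<lambda>n. \<Sum>r\<in>UNIV. class_cost lam \<nu> U r (n r))
        (workload_feasible route bottlenecks \<nu> (workload m)) x"
    proof (rule ccontr)
      assume "x \<noteq> m"
      then have "total_cost m < total_cost x"
        using that least by (simp add: is_arg_min_def)
      moreover have "workload_feasible route bottlenecks \<nu> (workload m) m"
        using m by (simp add: feas)
      ultimately show False
        using that by (auto simp: is_arg_min_def total_cost_def)
    qed
    show "is_arg_min (\<lambda>n. \<Sum>r\<in>UNIV. class_cost lam \<nu> U r (n r))
        (workload_feasible route bottlenecks \<nu> (workload m)) x" if "x = m"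
    proof -
      have "\<not> total_cost n < total_cost m"
        if "workload_feasible route bottlenecks \<nu> (workload m) n" for n
        using least[OF that] by (cases "n = m") auto
      then show ?thesis
        using that m by (auto simp: is_arg_min_def feas total_cost_def)
    qed
  qed
  then show ?thesis
    unfolding fixed_point_def by (intro the_equality) blast+
qed

text \<open>Once a path with nonincreasing cost and nondecreasing bottleneck workloads visits a state \<open>m\<close> of cost at
  most \<open>K\<close> and dissipation less than \<open>\<gamma>\<close>, it remains within distance \<open>\<epsilon>\<close> of \<open>m\<close>.\<close>
definition traps :: "real \<Rightarrow> real \<Rightarrow> real \<Rightarrow> bool" where
  "traps K \<gamma> \<epsilon> \<longleftrightarrow> (\<forall>m n. (\<forall>r. 0 \<le> m r) \<and> (\<forall>r. 0 \<le> n r) \<and> total_cost m \<le> K \<and>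
      dissipation m < \<gamma> \<and> total_cost n \<le> total_cost m \<and>
      (\<forall>l\<in>bottlenecks. workload m l \<le> workload n l) \<longrightarrow> l1norm (\<lambda>r. n r - m r) < \<epsilon>)"

text \<open>Otherwise there are states \<open>m\<^sub>j\<close> and \<open>n\<^sub>j\<close> at distance at least \<open>\<epsilon>\<close> that violate the claim with
  \<open>\<gamma> = 1 / (j + 1)\<close>. Both sequences lie in a compact sublevel set. In the limit \<open>m\<close> has no dissipation,
  while \<open>n\<close> costs no more than \<open>m\<close> and carries at least its workload, so \<open>n = m\<close>, which contradicts the
  distance.\<close>
lemma small_dissipation_traps:
  assumes "0 < \<epsilon>"
  shows "\<exists>\<gamma>>0. traps K \<gamma> \<epsilon>"
proof (rule ccontr)
  assume contr: "\<not> ?thesis"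
  define bad where "bad \<gamma> m n \<longleftrightarrow> ((\<forall>r. 0 \<le> m r) \<and> (\<forall>r. 0 \<le> n r) \<and> total_cost m \<le> K \<and>
      dissipation m < \<gamma> \<and> total_cost n \<le> total_cost m \<and>
      (\<forall>l\<in>bottlenecks. workload m l \<le> workload n l)) \<and> \<not> l1norm (\<lambda>r. n r - m r) < \<epsilon>" for \<gamma> m n
  have "\<exists>m n. bad \<gamma> m n" if "0 < \<gamma>" for \<gamma>
    using contr that unfolding traps_def bad_def by blast
  then have "\<exists>m n. bad (inverse (real (Suc j))) m n" for j
    by simp
  then obtain m n where bad: "\<And>j. bad (inverse (real (Suc j))) (m j) (n j)"
    by metis
  have nonneg: "0 \<le> m j r" "0 \<le> n j r" for j r
    using bad[of j] by (simp_all add: bad_def)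
  obtain b where b: "\<And>n r. (\<And>q. 0 \<le> n q) \<Longrightarrow> total_cost n \<le> K \<Longrightarrow> n r \<le> b"
    using sublevel_bounded by blast
  have "m j r \<le> b" "n j r \<le> b" for j r
  proof -
    have "total_cost (m j) \<le> K" "total_cost (n j) \<le> K"
      using bad[of j] by (auto simp: bad_def)
    then show "m j r \<le> b" "n j r \<le> b"
      using b nonneg by blast+
  qed
  with nonneg have bound: "\<bar>m j r\<bar> \<le> b" "\<bar>n j r\<bar> \<le> b" for j r
    by (simp_all add: abs_le_iff order_trans[of _ 0])
  obtain s\<^sub>1 m' where s1: "strict_mono s\<^sub>1" and "\<And>r. (\<lambda>j. m (s\<^sub>1 j) r) \<longlonglongrightarrow> m' r"
    using bounded_vectors_convergent_subseq[of m] bound(1) by blast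
  moreover obtain s\<^sub>2 n' where s2: "strict_mono s\<^sub>2"
    and n': "\<And>r. (\<lambda>j. n (s\<^sub>1 (s\<^sub>2 j)) r) \<longlonglongrightarrow> n' r"
    using bounded_vectors_convergent_subseq[of "\<lambda>j. n (s\<^sub>1 j)"] bound(2) by blast
  ultimately have m': "\<And>r. (\<lambda>j. m (s\<^sub>1 (s\<^sub>2 j)) r) \<longlonglongrightarrow> m' r"
    using LIMSEQ_subseq_LIMSEQ[OF _ s2] by (force simp: o_def)
  define s where "s j = s\<^sub>1 (s\<^sub>2 j)" for j
  have s: "strict_mono s"
    using strict_mono_o[OF s1 s2] by (simp add: s_def[abs_def] o_def)
  note m' = m'[folded s_def] and n' = n'[folded s_def]
  have "0 \<le> m' r" "0 \<le> n' r" for r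
    using nonneg by (auto intro: LIMSEQ_le_const[OF m'] LIMSEQ_le_const[OF n'])
  note nonneg' = this
  have "(\<lambda>j. dissipation (m (s j))) \<longlonglongrightarrow> dissipation m'"
    by (rule dissipation_tendsto) (use nonneg nonneg' m' in auto)
  moreover have "(\<lambda>j. inverse (real (Suc (s j)))) \<longlonglongrightarrow> 0"
    using LIMSEQ_subseq_LIMSEQ[OF LIMSEQ_inverse_real_of_nat s] by (simp add: o_def)
  ultimately have "dissipation m' \<le> 0"
    using bad by (intro LIMSEQ_le) (auto simp: bad_def less_imp_le)
  then have "dissipation m' = 0"
    using dissipation_nonneg[of m'] nonneg' by force
  moreover have "workload m' l \<le> workload n' l" if "l \<in> bottlenecks" for l
    by (rule LIMSEQ_le[OF workload_tendsto[OF m'] workload_tendsto[OF n']])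
      (use bad that in \<open>auto simp: bad_def\<close>)
  moreover have "total_cost n' \<le> total_cost m'"
    by (rule LIMSEQ_le[OF total_cost_tendsto[OF _ _ n'] total_cost_tendsto[OF _ _ m']])
      (use bad nonneg nonneg' in \<open>auto simp: bad_def\<close>)
  ultimately have "n' = m'"
    using stationary_minimizes_cost[of m' n'] nonneg' by force
  have "(\<lambda>j. n (s j) r - m (s j) r) \<longlonglongrightarrow> 0" for r
    using tendsto_diff[OF n'[of r] m'[of r]] \<open>n' = m'\<close> by simp
  then have "(\<lambda>j. l1norm (\<lambda>r. n (s j) r - m (s j) r)) \<longlonglongrightarrow> 0"
    by (rule l1norm_tendsto_zero)
  then have "\<epsilon> \<le> 0"
    by (rule LIMSEQ_le_const) (use bad in \<open>auto simp: bad_def not_less\<close>)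
  then show False using \<open>0 < \<epsilon>\<close> by simp
qed

section \<open>Fluid paths\<close>

text \<open>The properties of fluid limits that drive the convergence. The derivative is one-sided at
  time 0, and it is not prescribed at times at which the class is empty.\<close>
definition fluid_path :: "(real \<Rightarrow> 'r \<Rightarrow> real) \<Rightarrow> bool" where
  "fluid_path N \<longleftrightarrow>
     (\<forall>t\<ge>0. \<forall>r. 0 \<le> N t r) \<and>
     (\<exists>L. \<forall>s\<ge>0. \<forall>t\<ge>0. \<forall>r. \<bar>N t r - N s r\<bar> \<le> L * \<bar>t - s\<bar>) \<and>
     (\<forall>t\<ge>0. \<forall>r. 0 < N t r \<longrightarrow>
        ((\<lambda>t. N t r) has_real_derivative lam r - \<Lambda> (N t) r / \<nu> r) (at t within {0..})) \<and>
     (\<forall>l\<in>bottlenecks. \<forall>s\<ge>0. \<forall>t\<ge>s. workload (N s) l \<le> workload (N t) l)"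

lemma fluid_path_nonneg: "fluid_path N \<Longrightarrow> 0 \<le> t \<Longrightarrow> 0 \<le> N t r"
  by (simp add: fluid_path_def)

text \<open>At a time with \<open>N t r = 0\<close> the path need not be differentiable, but \<open>\<bar>N s r\<bar> \<le> L * \<bar>s - t\<bar>\<close> and the
  cost is of smaller order than its argument near 0, so that the composition has derivative 0. This agrees
  with the formula because \<open>\<phi> r 0 = 0\<close>.\<close>
lemma class_cost_along_path:
  assumes N: "fluid_path N" and t: "0 \<le> t"
  shows "((\<lambda>t. class_cost lam \<nu> U r (N t r)) has_real_derivative
    - (\<phi> r (N t r) * (\<Lambda> (N t) r - \<rho> r))) (at t within {0..})"
proof (cases "N t r = 0")
  case False
  then have "0 < N t r" using fluid_path_nonneg[OF N t, of r] by simp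
  then have N': "((\<lambda>t. N t r) has_real_derivative lam r - \<Lambda> (N t) r / \<nu> r) (at t within {0..})"
    using N t by (simp add: fluid_path_def)
  have "(class_cost lam \<nu> U r has_real_derivative \<nu> r * \<phi> r (N t r))
      (at (N t r) within (\<lambda>t. N t r) ` {0..})"
    by (rule DERIV_subset[OF class_cost_has_derivative]) (use fluid_path_nonneg[OF N] t in auto)
  from DERIV_image_chain[OF this N']
  have "((\<lambda>t. class_cost lam \<nu> U r (N t r)) has_real_derivative
      \<nu> r * \<phi> r (N t r) * (lam r - \<Lambda> (N t) r / \<nu> r)) (at t within {0..})"
    by (simp add: o_def)
  moreover have "\<nu> r * \<phi> r (N t r) * (lam r - \<Lambda> (N t) r / \<nu> r)
      = - (\<phi> r (N t r) * (\<Lambda> (N t) r - \<rho> r))"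
    using \<nu>_pos[of r] by (simp add: offered_load_def field_simps)
  ultimately show ?thesis by simp
next
  case True
  have "\<exists>L. \<forall>s\<ge>0. \<forall>t\<ge>0. \<forall>r. \<bar>N t r - N s r\<bar> \<le> L * \<bar>t - s\<bar>"
    using N unfolding fluid_path_def by (elim conjE)
  then obtain L\<^sub>0 where Lipschitz: "\<forall>s\<ge>0. \<forall>t\<ge>0. \<forall>r. \<bar>N t r - N s r\<bar> \<le> L\<^sub>0 * \<bar>t - s\<bar>"
    by (rule exE)
  have L0: "\<bar>N s r\<bar> \<le> L\<^sub>0 * \<bar>s - t\<bar>" if "0 \<le> s" for s
    using Lipschitz[rule_format, OF t that, of r] True by simp
  define L where "L = \<bar>L\<^sub>0\<bar> + 1"
  have "0 < L" by (simp add: L_def)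
  have L: "\<bar>N s r\<bar> \<le> L * \<bar>s - t\<bar>" if "0 \<le> s" for s
    by (rule order_trans[OF L0[OF that]]) (auto simp: L_def intro: mult_right_mono)
  have zero: "(class_cost lam \<nu> U r has_derivative (\<lambda>h. 0)) (at 0 within {0..})"
    using class_cost_has_derivative[of 0 r] by (simp add: \<phi>_zero has_field_derivative_def lambda_zero)
  have "((\<lambda>t. class_cost lam \<nu> U r (N t r)) has_derivative (\<lambda>h. 0)) (at t within {0..})"
    unfolding has_derivative_within_alt
  proof (intro conjI allI impI bounded_linear_zero)
    fix e :: real assume "0 < e"
    then have "0 < e / L" using \<open>0 < L\<close> by simp
    then obtain d where "0 < d"
      and "\<forall>y\<in>{0..}. norm (y - 0) < d \<longrightarrow> norm (class_cost lam \<nu> U r y - class_cost lam \<nu> U r 0 - 0)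
        \<le> e / L * norm (y - 0)"
      using zero[unfolded has_derivative_within_alt] by metis
    then have d: "\<bar>class_cost lam \<nu> U r y\<bar> \<le> e / L * \<bar>y\<bar>" if "0 \<le> y" "\<bar>y\<bar> < d" for y
      using that by (simp add: class_cost_zero)
    show "\<exists>d>0. \<forall>s\<in>{0..}. norm (s - t) < d \<longrightarrow>
        norm (class_cost lam \<nu> U r (N s r) - class_cost lam \<nu> U r (N t r) - 0) \<le> e * norm (s - t)"
    proof (intro exI conjI ballI impI)
      show "0 < d / L" using \<open>0 < d\<close> \<open>0 < L\<close> by simp
      fix s assume s: "s \<in> {0..}" "norm (s - t) < d / L"
      then have "L * \<bar>s - t\<bar> < d"
        using \<open>0 < L\<close> by (simp add: field_simps)
      then have "\<bar>class_cost lam \<nu> U r (N s r)\<bar> \<le> e / L * \<bar>N s r\<bar>"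
        using d[of "N s r"] L[of s] s fluid_path_nonneg[OF N, of s r] by simp
      also have "\<dots> \<le> e / L * (L * \<bar>s - t\<bar>)"
        using L[of s] s \<open>0 < e / L\<close> by (intro mult_left_mono) auto
      also have "\<dots> = e * \<bar>s - t\<bar>"
        using \<open>0 < L\<close> by simp
      finally show "norm (class_cost lam \<nu> U r (N s r) - class_cost lam \<nu> U r (N t r) - 0)
          \<le> e * norm (s - t)"
        using True by (simp add: class_cost_zero)
    qed
  qed
  then show ?thesis
    using True by (simp add: \<phi>_zero has_field_derivative_def lambda_zero)
qed

lemma total_cost_along_path:
  assumes "fluid_path N" "0 \<le> t"
  shows "((\<lambda>t. total_cost (N t)) has_real_derivative - dissipation (N t)) (at t within {0..})"
  unfolding total_cost_def dissipation_def sum_negf[symmetric]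
  by (intro DERIV_sum class_cost_along_path assms)

lemma total_cost_increment:
  assumes N: "fluid_path N" and "0 \<le> s" "s < t"
  shows "\<exists>z\<in>{s<..<t}. total_cost (N t) - total_cost (N s) = - dissipation (N z) * (t - s)"
  by (rule mvt_simple[OF \<open>s < t\<close> has_derivative_subset
        [OF total_cost_along_path[OF N, unfolded has_field_derivative_def]]])
    (use assms in auto)

lemma total_cost_antimono_along_path:
  assumes N: "fluid_path N" and "0 \<le> s" "s \<le> t"
  shows "total_cost (N t) \<le> total_cost (N s)"
proof (cases "s = t")
  case False
  then obtain z where "z \<in> {s<..<t}"
    and "total_cost (N t) - total_cost (N s) = - dissipation (N z) * (t - s)"
    using total_cost_increment[OF N, of s t] assms by auto
  moreover from this have "0 \<le> dissipation (N z) * (t - s)"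
    using dissipation_nonneg[of "N z"] fluid_path_nonneg[OF N, of z] assms by simp
  ultimately show ?thesis by simp
qed simp

text \<open>Dissipation at least \<open>\<gamma>\<close> over a time interval of this length would cost more than \<open>K\<close>.\<close>
lemma dissipation_becomes_small:
  assumes N: "fluid_path N" and K: "total_cost (N 0) \<le> K" and "0 < \<gamma>" and "0 \<le> s"
  shows "\<exists>t. s \<le> t \<and> t \<le> s + (K / \<gamma> + 1) \<and> dissipation (N t) < \<gamma>"
proof -
  have "0 \<le> K"
    using total_cost_nonneg[of "N 0"] fluid_path_nonneg[OF N, of 0] K by simp
  then have len: "0 < K / \<gamma> + 1"
    using \<open>0 < \<gamma>\<close> by (simp add: add_nonneg_pos)
  then obtain z where z: "z \<in> {s<..<s + (K / \<gamma> + 1)}"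
    and eq: "total_cost (N (s + (K / \<gamma> + 1))) - total_cost (N s)
      = - dissipation (N z) * (K / \<gamma> + 1)"
    using total_cost_increment[OF N \<open>0 \<le> s\<close>, of "s + (K / \<gamma> + 1)"] by auto
  have "0 \<le> total_cost (N (s + (K / \<gamma> + 1)))"
    using len \<open>0 \<le> s\<close> by (intro total_cost_nonneg fluid_path_nonneg[OF N]) simp
  then have "dissipation (N z) * (K / \<gamma> + 1) \<le> K"
    using eq K total_cost_antimono_along_path[OF N, of 0 s] \<open>0 \<le> s\<close> by simp
  also have "K < \<gamma> * (K / \<gamma> + 1)"
    using \<open>0 < \<gamma>\<close> by (simp add: field_simps)
  finally have "dissipation (N z) < \<gamma>"
    using len by (simp add: mult_less_cancel_right)
  then show ?thesis using z by (intro exI[of _ z]) auto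
qed

text \<open>With \<open>\<gamma>\<close> chosen for distance \<open>\<epsilon> / 3\<close>, a moment \<open>s\<close> with dissipation below \<open>\<gamma>\<close> occurs before the
  common time \<open>T \<epsilon>\<close>, and the path stays within \<open>\<epsilon> / 3\<close> of \<open>N s\<close> afterwards. This yields both the Cauchy
  property and the uniform rate.\<close>
theorem fluid_paths_uniformly_attracted:
  assumes "0 \<le> K"
  shows "\<exists>T. (\<forall>\<epsilon>>0. 0 < T \<epsilon>) \<and> (\<forall>N. fluid_path N \<longrightarrow> total_cost (N 0) \<le> K \<longrightarrow>
    (\<exists>m. (\<forall>r. 0 \<le> m r) \<and> dissipation m = 0 \<and>
      (\<forall>\<epsilon>>0. \<forall>t>T \<epsilon>. l1norm (\<lambda>r. N t r - m r) < \<epsilon>)))"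
proof -
  have "\<exists>\<gamma>. 0 < \<epsilon> \<longrightarrow> 0 < \<gamma> \<and> traps K \<gamma> (\<epsilon> / 3)" for \<epsilon> :: real
    using small_dissipation_traps[of "\<epsilon> / 3" K] by (cases "0 < \<epsilon>") auto
  then obtain \<gamma> where "\<forall>\<epsilon>. 0 < \<epsilon> \<longrightarrow> 0 < \<gamma> \<epsilon> \<and> traps K (\<gamma> \<epsilon>) (\<epsilon> / 3)"
    using choice[of "\<lambda>\<epsilon> \<gamma>. 0 < \<epsilon> \<longrightarrow> 0 < \<gamma> \<and> traps K \<gamma> (\<epsilon> / 3)"] by blast
  then have \<gamma>: "0 < \<gamma> \<epsilon>" and trap: "traps K (\<gamma> \<epsilon>) (\<epsilon> / 3)" if "0 < \<epsilon>" for \<epsilon>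
    using that by blast+
  define T where "T \<epsilon> = K / \<gamma> \<epsilon> + 1" for \<epsilon>
  have T_pos: "0 < T \<epsilon>" if "0 < \<epsilon>" for \<epsilon>
    using \<gamma>[OF that] \<open>0 \<le> K\<close> by (simp add: T_def add_nonneg_pos)
  have "\<exists>m. (\<forall>r. 0 \<le> m r) \<and> dissipation m = 0 \<and>
      (\<forall>\<epsilon>>0. \<forall>t>T \<epsilon>. l1norm (\<lambda>r. N t r - m r) < \<epsilon>)"
    if N: "fluid_path N" and K: "total_cost (N 0) \<le> K" for N
  proof -
    note nonneg = fluid_path_nonneg[OF N]
    have settles: "\<exists>s\<ge>0. s \<le> T \<epsilon> \<and> (\<forall>t\<ge>s. l1norm (\<lambda>r. N t r - N s r) < \<epsilon> / 3)" if "0 < \<epsilon>" for \<epsilon>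
    proof -
      obtain s where s: "0 \<le> s" "s \<le> T \<epsilon>" "dissipation (N s) < \<gamma> \<epsilon>"
        using dissipation_becomes_small[OF N K \<gamma>[OF \<open>0 < \<epsilon>\<close>], of 0] by (auto simp: T_def)
      have "l1norm (\<lambda>r. N t r - N s r) < \<epsilon> / 3" if "s \<le> t" for t
      proof (rule trap[OF \<open>0 < \<epsilon>\<close>, unfolded traps_def, rule_format], intro conjI allI ballI)
        show "total_cost (N s) \<le> K"
          using total_cost_antimono_along_path[OF N, of 0 s] s K by simp
        show "total_cost (N t) \<le> total_cost (N s)"
          by (rule total_cost_antimono_along_path[OF N]) (use s that in auto)
        show "workload (N s) l \<le> workload (N t) l" if "l \<in> bottlenecks" for l
          using N s \<open>s \<le> t\<close> that by (simp add: fluid_path_def)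
      qed (use s that nonneg in auto)
      then show ?thesis using s by blast
    qed
    have Cauchy: "Cauchy (\<lambda>j. N (real j) r)" for r
    proof (rule metric_CauchyI)
      fix e :: real assume "0 < e"
      then obtain s where s: "\<And>t. s \<le> t \<Longrightarrow> l1norm (\<lambda>r. N t r - N s r) < e / 3"
        using settles by blast
      have close: "\<bar>N t r - N s r\<bar> < e / 3" if "s \<le> t" for t
        using abs_le_l1norm[of "\<lambda>r. N t r - N s r" r] s[OF that] by simp
      obtain M where "s \<le> real M" using real_arch_simple by blast
      then have tail: "\<bar>N (real j) r - N s r\<bar> < e / 3" if "M \<le> j" for j
        using that by (intro close) (simp add: order_trans)
      have "dist (N (real i) r) (N (real j) r) < e" if "M \<le> i" "M \<le> j" for i j
      proof -
        have "dist (N (real i) r) (N s r) < e / 3" "dist (N (real j) r) (N s r) < e / 3"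
          using tail that by (simp_all add: dist_real_def)
        then show ?thesis
          using dist_triangle2[of "N (real i) r" "N (real j) r" "N s r"] \<open>0 < e\<close> by linarith
      qed
      then show "\<exists>M. \<forall>i\<ge>M. \<forall>j\<ge>M. dist (N (real i) r) (N (real j) r) < e"
        by blast
    qed
    define m where "m r = lim (\<lambda>j. N (real j) r)" for r
    have m: "(\<lambda>j. N (real j) r) \<longlonglongrightarrow> m r" for r
      using Cauchy_convergent[OF Cauchy] by (simp add: m_def convergent_LIMSEQ_iff)
    have attracted: "l1norm (\<lambda>r. N t r - m r) < \<epsilon>" if "0 < \<epsilon>" "T \<epsilon> < t" for \<epsilon> t
    proof -
      obtain s where s: "s \<le> T \<epsilon>" "\<And>t. s \<le> t \<Longrightarrow> l1norm (\<lambda>r. N t r - N s r) < \<epsilon> / 3"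
        using settles[OF \<open>0 < \<epsilon>\<close>] by blast
      have "(\<lambda>j. l1norm (\<lambda>r. N (real j) r - N s r)) \<longlonglongrightarrow> l1norm (\<lambda>r. m r - N s r)"
        unfolding l1norm_def by (intro tendsto_intros m)
      moreover obtain M where "s \<le> real M" using real_arch_simple by blast
      ultimately have "l1norm (\<lambda>r. m r - N s r) \<le> \<epsilon> / 3"
        using s(2) by (intro LIMSEQ_le_const2) (auto intro!: exI[of _ M] less_imp_le)
      moreover have "l1norm (\<lambda>r. N t r - N s r) < \<epsilon> / 3"
        using s that by simp
      ultimately show ?thesis
        using l1norm_triangle[of "N t" m "N s"] l1norm_commute[of m "N s"] \<open>0 < \<epsilon>\<close> by simp
    qed
    have "0 \<le> m r" for r
      by (rule LIMSEQ_le_const[OF m]) (use nonneg in auto)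
    moreover have "dissipation m = 0"
    proof -
      \<comment> \<open>Small dissipation recurs at arbitrarily late times, so it passes to the limit.\<close>
      have "\<exists>t\<ge>real j. dissipation (N t) < inverse (real (Suc j))" for j
        using dissipation_becomes_small[OF N K, of "inverse (real (Suc j))" "real j"] by auto
      then obtain \<tau> where \<tau>: "\<And>j. real j \<le> \<tau> j" "\<And>j. dissipation (N (\<tau> j)) < inverse (real (Suc j))"
        by metis
      have \<tau>_nonneg: "0 \<le> \<tau> j" for j using \<tau>(1)[of j] by (rule order_trans[rotated]) simp
      have lim: "(\<lambda>j. N (\<tau> j) r) \<longlonglongrightarrow> m r" for r
      proof (rule tendstoI)
        fix e :: real assume "0 < e"
        have "\<forall>\<^sub>F j in sequentially. T e < real j"
          using filterlim_real_sequentially by (simp add: filterlim_at_top_dense)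
        then show "\<forall>\<^sub>F j in sequentially. dist (N (\<tau> j) r) (m r) < e"
        proof (rule eventually_mono)
          fix j assume "T e < real j"
          then have "l1norm (\<lambda>r. N (\<tau> j) r - m r) < e"
            using attracted[OF \<open>0 < e\<close>] \<tau>(1)[of j] by simp
          then show "dist (N (\<tau> j) r) (m r) < e"
            using abs_le_l1norm[of "\<lambda>r. N (\<tau> j) r - m r" r] by (simp add: dist_real_def)
        qed
      qed
      have "dissipation m \<le> 0"
      proof (rule LIMSEQ_le)
        show "(\<lambda>j. dissipation (N (\<tau> j))) \<longlonglongrightarrow> dissipation m"
          by (rule dissipation_tendsto) (use \<open>\<And>r. 0 \<le> m r\<close> nonneg \<tau>_nonneg lim in auto)
        show "(\<lambda>j. inverse (real (Suc j))) \<longlonglongrightarrow> 0" by (rule LIMSEQ_inverse_real_of_nat)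
      qed (use \<tau>(2) less_imp_le in blast)
      then show ?thesis using dissipation_nonneg[of m] \<open>\<And>r. 0 \<le> m r\<close> by force
    qed
    ultimately show ?thesis using attracted by blast
  qed
  then show ?thesis using T_pos by blast
qed

end

section \<open>Fluid limits are fluid paths\<close>

lemma network_path_increment:
  assumes path: "network_path route Lb \<rho> \<Lambda> \<nu> a b N D W Y" and "0 \<le> s" "s \<le> t"
  shows "((\<lambda>x. \<Lambda> (\<lambda>q. real (N x q)) r * of_bool (0 < N x r)) has_integral D t r - D s r) {s..t}"
proof -
  let ?f = "\<lambda>x. \<Lambda> (\<lambda>q. real (N x q)) r * of_bool (0 < N x r)"
  have int: "(?f has_integral D u r) {0..u}" if "0 \<le> u" for u
    using path that by (simp add: network_path_def)
  have "?f integrable_on {0..t}"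
    using int[of t] assms by (auto simp: integrable_on_def)
  then have "integral {0..s} ?f + integral {s..t} ?f = integral {0..t} ?f" "?f integrable_on {s..t}"
    using assms by (auto intro: Henstock_Kurzweil_Integration.integral_combine
        integrable_subinterval_real)
  moreover have "integral {0..s} ?f = D s r" "integral {0..t} ?f = D t r"
    using int assms by (auto intro: integral_unique)
  ultimately show ?thesis
    by (simp add: has_integral_integrable_integral algebra_simps)
qed

lemma network_path_balance:
  assumes "network_path route Lb \<rho> \<Lambda> \<nu> a b N D W Y" "0 \<le> t"
  shows "real (N t r) =
    real (N 0 r) + real (renewal_count (a r) t) - real (renewal_count (b r) (D t r))"
  using assms unfolding network_path_def by blast

lemma network_path_workload:
  assumes "network_path route Lb \<rho> \<Lambda> \<nu> a b N D W Y" "0 \<le> t" "l \<in> Lb"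
  shows "W t l = (\<Sum>r | l \<in> route r. \<nu> r * real (N t r))"
  using assms unfolding network_path_def by blast

lemma network_path_initial:
  assumes "network_path route Lb \<rho> \<Lambda> \<nu> a b N D W Y"
  shows "D 0 r = 0"
proof -
  let ?f = "\<lambda>x. \<Lambda> (\<lambda>q. real (N x q)) r * of_bool (0 < N x r)"
  have "(?f has_integral D 0 r) {0..0}"
    using assms unfolding network_path_def by blast
  moreover have "(?f has_integral 0) {0..0}"
    by (simp add: has_integral_refl)
  ultimately show ?thesis by (rule has_integral_unique)
qed

text \<open>The scaled networks and their limit along one subsequence \<open>\<sigma>\<close>. Properties of a
  single network are stated for \<open>j \<ge> 1\<close>, since \<open>\<sigma> 0\<close> may be 0 and scaling by 0 is meaningless.\<close>
locale fluid_scaling = utility_network route c lam \<nu> U \<Lambda>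
  for route :: "'r::finite \<Rightarrow> 'l::finite set"
    and c :: "'l \<Rightarrow> real"
    and lam \<nu> :: "'r \<Rightarrow> real"
    and U :: "'r \<Rightarrow> real \<Rightarrow> real \<Rightarrow> real"
    and \<Lambda> :: "('r \<Rightarrow> real) \<Rightarrow> 'r \<Rightarrow> real" +
  fixes \<sigma> :: "nat \<Rightarrow> nat"
    and \<nu>k :: "nat \<Rightarrow> 'r \<Rightarrow> real"
    and u v :: "nat \<Rightarrow> 'r \<Rightarrow> nat \<Rightarrow> real"
    and Nk :: "nat \<Rightarrow> real \<Rightarrow> 'r \<Rightarrow> nat"
    and Dk :: "nat \<Rightarrow> real \<Rightarrow> 'r \<Rightarrow> real"
    and Wk Yk :: "nat \<Rightarrow> real \<Rightarrow> 'l \<Rightarrow> real"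
    and N D :: "real \<Rightarrow> 'r \<Rightarrow> real"
    and W :: "real \<Rightarrow> 'l \<Rightarrow> real"
  assumes \<sigma>: "strict_mono \<sigma>"
    and path: "1 \<le> k \<Longrightarrow> network_path route bottlenecks \<rho> \<Lambda> (\<nu>k k) (u k) (v k)
      (Nk k) (Dk k) (Wk k) (Yk k)"
    and arrivals: "scaled_limit \<sigma> (\<lambda>k t. real (renewal_count (u k r) t)) (\<lambda>t. lam r * t)"
    and services: "scaled_limit \<sigma> (\<lambda>k y. real (renewal_count (v k r) y)) (\<lambda>y. y / \<nu> r)"
    and N_limit: "scaled_limit \<sigma> (\<lambda>k t. real (Nk k t r)) (\<lambda>t. N t r)"
    and D_limit: "scaled_limit \<sigma> (\<lambda>k t. Dk k t r) (\<lambda>t. D t r)"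
    and W_limit: "l \<in> bottlenecks \<Longrightarrow> scaled_limit \<sigma> (\<lambda>k t. Wk k t l) (\<lambda>t. W t l)"
    and \<nu>_limit: "(\<lambda>k. \<nu>k k r) \<longlonglongrightarrow> \<nu> r"
begin

definition scaling :: "nat \<Rightarrow> real" where
  "scaling j = real (\<sigma> j)"

definition N_scaled :: "nat \<Rightarrow> real \<Rightarrow> 'r \<Rightarrow> real" where
  "N_scaled j t r = real (Nk (\<sigma> j) (scaling j * t) r) / scaling j"

definition D_scaled :: "nat \<Rightarrow> real \<Rightarrow> 'r \<Rightarrow> real" where
  "D_scaled j t r = Dk (\<sigma> j) (scaling j * t) r / scaling j"

lemma \<sigma>_pos: "1 \<le> j \<Longrightarrow> 1 \<le> \<sigma> j"
  using seq_suble[OF \<sigma>, of j] by simp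

lemma scaling_pos: "1 \<le> j \<Longrightarrow> 0 < scaling j"
  using \<sigma>_pos[of j] by (simp add: scaling_def)

lemma scaled_path:
  "1 \<le> j \<Longrightarrow> network_path route bottlenecks \<rho> \<Lambda> (\<nu>k (\<sigma> j)) (u (\<sigma> j)) (v (\<sigma> j))
      (Nk (\<sigma> j)) (Dk (\<sigma> j)) (Wk (\<sigma> j)) (Yk (\<sigma> j))"
  by (rule path[OF \<sigma>_pos])

lemma scaled_limit_pointwise:
  assumes "scaled_limit \<sigma> X x" "0 \<le> t"
  shows "(\<lambda>j. X (\<sigma> j) (scaling j * t) / scaling j) \<longlonglongrightarrow> x t"
proof -
  have "uniform_limit {0..t} (\<lambda>j t. X (\<sigma> j) (scaling j * t) / scaling j) x sequentially"
    using assms(1) by (simp add: scaled_limit_def scaling_def)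
  from tendsto_uniform_limitI[OF this, of t] show ?thesis using assms(2) by simp
qed

lemma N_scaled_nonneg: "0 \<le> N_scaled j t r"
  by (simp add: N_scaled_def scaling_def)

lemma N_scaled_tendsto: "0 \<le> t \<Longrightarrow> (\<lambda>j. N_scaled j t r) \<longlonglongrightarrow> N t r"
  using scaled_limit_pointwise[OF N_limit] by (simp add: N_scaled_def)

lemma D_scaled_tendsto: "0 \<le> t \<Longrightarrow> (\<lambda>j. D_scaled j t r) \<longlonglongrightarrow> D t r"
  using scaled_limit_pointwise[OF D_limit] by (simp add: D_scaled_def)

text \<open>Radial homogeneity lets the allocation be evaluated at the scaled state. It applies only to classes with
  jobs, and the indicator removes the others.\<close>
lemma D_scaled_increment:
  assumes "1 \<le> j" "0 \<le> s" "s \<le> t"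
  shows "((\<lambda>x. \<Lambda> (N_scaled j (x / scaling j)) r * of_bool (0 < N_scaled j (x / scaling j) r))
    has_integral scaling j * (D_scaled j t r - D_scaled j s r)) {scaling j * s..scaling j * t}"
proof -
  note pos = scaling_pos[OF \<open>1 \<le> j\<close>]
  have "((\<lambda>x. \<Lambda> (\<lambda>q. real (Nk (\<sigma> j) x q)) r * of_bool (0 < Nk (\<sigma> j) x r))
      has_integral Dk (\<sigma> j) (scaling j * t) r - Dk (\<sigma> j) (scaling j * s) r) {scaling j * s..scaling j * t}"
    by (rule network_path_increment[OF scaled_path[OF \<open>1 \<le> j\<close>]])
      (use pos assms in \<open>auto intro: mult_left_mono\<close>)
  also have "Dk (\<sigma> j) (scaling j * t) r - Dk (\<sigma> j) (scaling j * s) r = scaling j * (D_scaled j t r - D_scaled j s r)"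
    using pos by (simp add: D_scaled_def field_simps)
  also have "(\<lambda>x. \<Lambda> (\<lambda>q. real (Nk (\<sigma> j) x q)) r * of_bool (0 < Nk (\<sigma> j) x r))
      = (\<lambda>x. \<Lambda> (N_scaled j (x / scaling j)) r * of_bool (0 < N_scaled j (x / scaling j) r))"
  proof
    fix x
    have "\<Lambda> (\<lambda>q. 1 / scaling j * real (Nk (\<sigma> j) x q)) r = \<Lambda> (\<lambda>q. real (Nk (\<sigma> j) x q)) r"
      if "0 < Nk (\<sigma> j) x r"
      using homogeneous[unfolded radially_homogeneous_def, rule_format,
          of "\<lambda>q. real (Nk (\<sigma> j) x q)" "1 / scaling j" r] pos that
      by simp
    then show "\<Lambda> (\<lambda>q. real (Nk (\<sigma> j) x q)) r * of_bool (0 < Nk (\<sigma> j) x r)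
        = \<Lambda> (N_scaled j (x / scaling j)) r * of_bool (0 < N_scaled j (x / scaling j) r)"
      using pos by (auto simp: N_scaled_def[abs_def] of_bool_def)
  qed
  finally show ?thesis .
qed

text \<open>Bounds are stated for sums over a set \<open>R\<close> of classes: a singleton gives regularity of a single class,
  and the classes using a link give the capacity constraint.\<close>
lemma D_scaled_increment_bounds:
  assumes j: "1 \<le> j" and st: "0 \<le> s" "s \<le> t"
    and bounds: "\<And>x. s \<le> x \<Longrightarrow> x \<le> t \<Longrightarrow>
      lo \<le> (\<Sum>r\<in>R. \<Lambda> (N_scaled j x) r * of_bool (0 < N_scaled j x r)) \<and>
      (\<Sum>r\<in>R. \<Lambda> (N_scaled j x) r * of_bool (0 < N_scaled j x r)) \<le> hi"
  shows "lo * (t - s) \<le> (\<Sum>r\<in>R. D_scaled j t r - D_scaled j s r)" "(\<Sum>r\<in>R. D_scaled j t r - D_scaled j s r) \<le> hi * (t - s)"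
proof -
  note pos = scaling_pos[OF j]
  let ?f = "\<lambda>x. \<Sum>r\<in>R. \<Lambda> (N_scaled j (x / scaling j)) r * of_bool (0 < N_scaled j (x / scaling j) r)"
  have int: "(?f has_integral (\<Sum>r\<in>R. scaling j * (D_scaled j t r - D_scaled j s r))) {scaling j * s..scaling j * t}"
    by (intro has_integral_sum D_scaled_increment j st) simp
  have const: "((\<lambda>x. k) has_integral scaling j * (k * (t - s))) {scaling j * s..scaling j * t}" for k :: real
    using has_integral_const_real[of k "scaling j * s" "scaling j * t"] pos st
    by (simp add: mult_left_mono algebra_simps)
  have inside: "s \<le> x / scaling j \<and> x / scaling j \<le> t" if "x \<in> {scaling j * s..scaling j * t}" for x
    using that pos by (simp add: field_simps)
  have "scaling j * (lo * (t - s)) \<le> scaling j * (\<Sum>r\<in>R. D_scaled j t r - D_scaled j s r)"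
    using has_integral_le[OF const int] bounds inside by (simp add: sum_distrib_left)
  then show "lo * (t - s) \<le> (\<Sum>r\<in>R. D_scaled j t r - D_scaled j s r)"
    using pos by simp
  have "scaling j * (\<Sum>r\<in>R. D_scaled j t r - D_scaled j s r) \<le> scaling j * (hi * (t - s))"
    using has_integral_le[OF int const] bounds inside by (simp add: sum_distrib_left)
  then show "(\<Sum>r\<in>R. D_scaled j t r - D_scaled j s r) \<le> hi * (t - s)"
    using pos by simp
qed

lemma D_increment_bounds:
  assumes st: "0 \<le> s" "s \<le> t"
    and bounds: "\<forall>\<^sub>F j in sequentially. \<forall>x. s \<le> x \<longrightarrow> x \<le> t \<longrightarrow>
      lo \<le> (\<Sum>r\<in>R. \<Lambda> (N_scaled j x) r * of_bool (0 < N_scaled j x r)) \<and>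
      (\<Sum>r\<in>R. \<Lambda> (N_scaled j x) r * of_bool (0 < N_scaled j x r)) \<le> hi"
  shows "lo * (t - s) \<le> (\<Sum>r\<in>R. D t r - D s r)" "(\<Sum>r\<in>R. D t r - D s r) \<le> hi * (t - s)"
proof -
  have lim: "(\<lambda>j. \<Sum>r\<in>R. D_scaled j t r - D_scaled j s r) \<longlonglongrightarrow> (\<Sum>r\<in>R. D t r - D s r)"
    by (intro tendsto_intros D_scaled_tendsto) (use st in auto)
  have ev: "\<forall>\<^sub>F j in sequentially. lo * (t - s) \<le> (\<Sum>r\<in>R. D_scaled j t r - D_scaled j s r) \<and>
      (\<Sum>r\<in>R. D_scaled j t r - D_scaled j s r) \<le> hi * (t - s)"
    using bounds eventually_ge_at_top[of 1]
    by eventually_elim (intro conjI D_scaled_increment_bounds st; blast)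
  show "lo * (t - s) \<le> (\<Sum>r\<in>R. D t r - D s r)"
    by (rule tendsto_lowerbound[OF lim]) (use ev in \<open>auto elim: eventually_mono\<close>)
  show "(\<Sum>r\<in>R. D t r - D s r) \<le> hi * (t - s)"
    by (rule tendsto_upperbound[OF lim]) (use ev in \<open>auto elim: eventually_mono\<close>)
qed

lemma D_scaled_bounds:
  assumes "1 \<le> j" "0 \<le> t"
  shows "0 \<le> D_scaled j t r" "D_scaled j t r \<le> total_capacity * t"
proof -
  have "D_scaled j 0 r = 0"
    using network_path_initial[OF scaled_path[OF \<open>1 \<le> j\<close>]] by (simp add: D_scaled_def)
  then show "0 \<le> D_scaled j t r" "D_scaled j t r \<le> total_capacity * t"
    using D_scaled_increment_bounds[OF assms(1) order_refl assms(2), of 0 "{r}" total_capacity]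
      allocation_bounds[of "N_scaled j x" r for x] N_scaled_nonneg total_capacity_nonneg
    by (auto simp: of_bool_def)
qed

text \<open>The departures are the service counting process evaluated at the random time \<open>D_scaled j t r\<close>. As these
  times stay in a fixed compact interval, uniform convergence of the counting process allows the substitution.\<close>
lemma N_balance:
  assumes t: "0 \<le> t"
  shows "N t r = N 0 r + lam r * t - D t r / \<nu> r"
proof -
  define V where "V j y = real (renewal_count (v (\<sigma> j) r) (scaling j * y)) / scaling j" for j y
  define b where "b = total_capacity * t"
  have V: "uniform_limit {0..b} V (\<lambda>y. y / \<nu> r) sequentially"
    using services[of r] by (simp add: scaled_limit_def V_def[abs_def] scaling_def)
  have "(\<lambda>j. V j (D_scaled j t r) - D_scaled j t r / \<nu> r) \<longlonglongrightarrow> 0"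
  proof (rule tendstoI)
    fix e :: real assume "0 < e"
    show "\<forall>\<^sub>F j in sequentially. dist (V j (D_scaled j t r) - D_scaled j t r / \<nu> r) 0 < e"
      using uniform_limitD[OF V \<open>0 < e\<close>] eventually_ge_at_top[of 1]
    proof eventually_elim
      case (elim j)
      then have "D_scaled j t r \<in> {0..b}" using D_scaled_bounds[OF _ t, of j r] by (simp add: b_def)
      with elim show ?case by (simp add: dist_real_def)
    qed
  qed
  moreover have "(\<lambda>j. D_scaled j t r / \<nu> r) \<longlonglongrightarrow> D t r / \<nu> r"
    using \<nu>_pos[of r] by (intro tendsto_intros D_scaled_tendsto t) simp
  ultimately have "(\<lambda>j. (V j (D_scaled j t r) - D_scaled j t r / \<nu> r) + D_scaled j t r / \<nu> r) \<longlonglongrightarrow> 0 + D t r / \<nu> r"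
    by (rule tendsto_add)
  then have V_lim: "(\<lambda>j. V j (D_scaled j t r)) \<longlonglongrightarrow> D t r / \<nu> r" by simp
  have rhs: "(\<lambda>j. N_scaled j 0 r + real (renewal_count (u (\<sigma> j) r) (scaling j * t)) / scaling j - V j (D_scaled j t r))
      \<longlonglongrightarrow> N 0 r + lam r * t - D t r / \<nu> r"
    by (intro tendsto_intros N_scaled_tendsto scaled_limit_pointwise[OF arrivals] V_lim t) simp
  have "\<forall>\<^sub>F j in sequentially. N_scaled j 0 r + real (renewal_count (u (\<sigma> j) r) (scaling j * t)) / scaling j
      - V j (D_scaled j t r) = N_scaled j t r"
    using eventually_ge_at_top[of 1]
  proof eventually_elim
    case (elim j)
    note pos = scaling_pos[OF elim]
    have "real (Nk (\<sigma> j) (scaling j * t) r) = real (Nk (\<sigma> j) 0 r)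
        + real (renewal_count (u (\<sigma> j) r) (scaling j * t))
        - real (renewal_count (v (\<sigma> j) r) (Dk (\<sigma> j) (scaling j * t) r))"
      by (rule network_path_balance[OF scaled_path[OF elim]]) (use pos t in simp)
    moreover have "scaling j * D_scaled j t r = Dk (\<sigma> j) (scaling j * t) r"
      using pos by (simp add: D_scaled_def)
    ultimately show ?case
      using pos by (simp add: N_scaled_def V_def add_divide_distrib diff_divide_distrib)
  qed
  then have "(\<lambda>j. N_scaled j t r) \<longlonglongrightarrow> N 0 r + lam r * t - D t r / \<nu> r"
    using rhs by (rule Lim_transform_eventually[rotated])
  then show ?thesis
    using N_scaled_tendsto[OF t] LIMSEQ_unique by blast
qed

lemma N_nonneg: "0 \<le> t \<Longrightarrow> 0 \<le> N t r"
  by (rule LIMSEQ_le_const[OF N_scaled_tendsto]) (auto simp: N_scaled_nonneg)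

lemma D_Lipschitz:
  assumes "0 \<le> s" "0 \<le> t"
  shows "\<bar>D t r - D s r\<bar> \<le> total_capacity * \<bar>t - s\<bar>"
proof -
  have "\<bar>D t r - D s r\<bar> \<le> total_capacity * (t - s)" if "0 \<le> s" "s \<le> t" for s t
    using D_increment_bounds[OF that, of 0 "{r}" total_capacity]
      allocation_bounds[of "N_scaled j x" r for j x] N_scaled_nonneg total_capacity_nonneg
    by (auto simp: of_bool_def)
  from this[of s t] this[of t s] assms show ?thesis
    by (cases "s \<le> t") (auto simp: abs_minus_commute)
qed

lemma N_Lipschitz:
  "\<exists>L. \<forall>s\<ge>0. \<forall>t\<ge>0. \<forall>r. \<bar>N t r - N s r\<bar> \<le> L * \<bar>t - s\<bar>"
proof -
  define L where "L r = lam r + total_capacity / \<nu> r" for r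
  have L_nonneg: "0 \<le> L r" for r
    using lam_pos[of r] \<nu>_pos[of r] total_capacity_nonneg by (simp add: L_def add_nonneg_nonneg)
  have "\<bar>N t r - N s r\<bar> \<le> (\<Sum>r\<in>UNIV. L r) * \<bar>t - s\<bar>" if "0 \<le> s" "0 \<le> t" for s t r
  proof -
    have "N t r - N s r = lam r * (t - s) - (D t r - D s r) / \<nu> r"
      using N_balance[of t r] N_balance[of s r] that
      by (simp add: diff_divide_distrib algebra_simps)
    also have "\<bar>\<dots>\<bar> \<le> lam r * \<bar>t - s\<bar> + \<bar>D t r - D s r\<bar> / \<nu> r"
      using abs_triangle_ineq4[of "lam r * (t - s)" "(D t r - D s r) / \<nu> r"] lam_pos[of r] \<nu>_pos[of r]
      by (simp add: abs_mult)
    also have "\<dots> \<le> lam r * \<bar>t - s\<bar> + total_capacity * \<bar>t - s\<bar> / \<nu> r"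
      using D_Lipschitz[OF that] \<nu>_pos[of r] by (intro add_left_mono divide_right_mono) auto
    also have "\<dots> = L r * \<bar>t - s\<bar>"
      by (simp add: L_def algebra_simps)
    also have "\<dots> \<le> (\<Sum>r\<in>UNIV. L r) * \<bar>t - s\<bar>"
      using L_nonneg by (intro mult_right_mono member_le_sum) auto
    finally show ?thesis .
  qed
  then show ?thesis by blast
qed

text \<open>Where \<open>N t r > 0\<close>, all scaled states near time \<open>t\<close> are eventually close to \<open>N t\<close> uniformly. Hence class
  \<open>r\<close> is nonempty in them and by continuity its allocation differs little from \<open>\<Lambda> (N t) r\<close>; so do the
  difference quotients of \<open>D\<close> in the limit.\<close>
lemma N_has_derivative:
  assumes t: "0 \<le> t" and r: "0 < N t r"
  shows "((\<lambda>t. N t r) has_real_derivative lam r - \<Lambda> (N t) r / \<nu> r) (at t within {0..})"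
proof -
  have "((\<lambda>t. D t r) has_derivative (\<lambda>h. \<Lambda> (N t) r * h)) (at t within {0..})"
    unfolding has_derivative_within_alt
  proof (intro conjI allI impI bounded_linear_mult_right)
    fix e :: real assume "0 < e"
    obtain \<delta>\<^sub>0 where "0 < \<delta>\<^sub>0" and \<delta>0: "\<forall>m. (\<forall>q. 0 \<le> m q) \<longrightarrow> (\<forall>q. \<bar>m q - N t q\<bar> < \<delta>\<^sub>0)
        \<longrightarrow> \<bar>\<Lambda> m r - \<Lambda> (N t) r\<bar> < e"
      using allocation_continuous[of "N t" r e] N_nonneg[OF t] r \<open>0 < e\<close> by metis
    \<comment> \<open>The second bound keeps class \<open>r\<close> nonempty.\<close>
    define \<delta> where "\<delta> = min \<delta>\<^sub>0 (N t r)"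
    have "0 < \<delta>" using \<open>0 < \<delta>\<^sub>0\<close> r by (simp add: \<delta>_def)
    obtain L where L: "\<forall>s\<ge>0. \<forall>t\<ge>0. \<forall>r. \<bar>N t r - N s r\<bar> \<le> L * \<bar>t - s\<bar>"
      using N_Lipschitz by blast
    define h where "h = \<delta> / (2 * (\<bar>L\<bar> + 1))"
    have "0 < h" using \<open>0 < \<delta>\<close> by (simp add: h_def)
    have near: "\<bar>N x q - N t q\<bar> < \<delta> / 2" if "0 \<le> x" "\<bar>x - t\<bar> < h" for x q
    proof -
      have "\<bar>N x q - N t q\<bar> \<le> L * \<bar>x - t\<bar>"
        using L t that by blast
      also have "\<dots> \<le> (\<bar>L\<bar> + 1) * \<bar>x - t\<bar>"
        by (intro mult_right_mono) auto
      also have "\<dots> < (\<bar>L\<bar> + 1) * h"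
        using that by (intro mult_strict_left_mono) auto
      also have "\<dots> = \<delta> / 2"
        by (simp add: h_def field_simps)
      finally show ?thesis .
    qed
    have "\<forall>\<^sub>F j in sequentially. \<forall>x\<in>{0..t + h}. dist (N_scaled j x q) (N x q) < \<delta> / 2" for q
    proof -
      have "uniform_limit {0..t + h} (\<lambda>j x. N_scaled j x q) (\<lambda>x. N x q) sequentially"
        using N_limit[of q] by (simp add: scaled_limit_def N_scaled_def[abs_def] scaling_def)
      from uniform_limitD[OF this, of "\<delta> / 2"] show ?thesis using \<open>0 < \<delta>\<close> by simp
    qed
    then have "\<forall>\<^sub>F j in sequentially. \<forall>q. \<forall>x\<in>{0..t + h}. dist (N_scaled j x q) (N x q) < \<delta> / 2"
      by (rule eventually_all_finite)
    then have ev: "\<forall>\<^sub>F j in sequentially. \<forall>x. 0 \<le> x \<longrightarrow> \<bar>x - t\<bar> < h \<longrightarrow>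
        \<Lambda> (N t) r - e \<le> \<Lambda> (N_scaled j x) r * of_bool (0 < N_scaled j x r) \<and>
        \<Lambda> (N_scaled j x) r * of_bool (0 < N_scaled j x r) \<le> \<Lambda> (N t) r + e"
    proof (rule eventually_mono, intro allI impI)
      fix j x
      assume unif: "\<forall>q. \<forall>x\<in>{0..t + h}. dist (N_scaled j x q) (N x q) < \<delta> / 2"
        and x: "0 \<le> x" "\<bar>x - t\<bar> < h"
      have close: "\<bar>N_scaled j x q - N t q\<bar> < \<delta>" for q
      proof -
        have "\<bar>N_scaled j x q - N x q\<bar> < \<delta> / 2"
          using unif x by (simp add: dist_real_def)
        then show ?thesis using near[OF x, of q] by linarith
      qed
      then have "\<bar>\<Lambda> (N_scaled j x) r - \<Lambda> (N t) r\<bar> < e"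
        using \<delta>0 N_scaled_nonneg by (simp add: \<delta>_def)
      moreover have "0 < N_scaled j x r"
        using close[of r] by (simp add: \<delta>_def abs_less_iff)
      ultimately show "\<Lambda> (N t) r - e \<le> \<Lambda> (N_scaled j x) r * of_bool (0 < N_scaled j x r) \<and>
          \<Lambda> (N_scaled j x) r * of_bool (0 < N_scaled j x r) \<le> \<Lambda> (N t) r + e"
        by auto
    qed
    have incr: "\<bar>D b r - D a r - \<Lambda> (N t) r * (b - a)\<bar> \<le> e * (b - a)"
      if "0 \<le> a" "a \<le> b" "\<bar>a - t\<bar> < h" "\<bar>b - t\<bar> < h" for a b
    proof -
      have "\<forall>\<^sub>F j in sequentially. \<forall>x. a \<le> x \<longrightarrow> x \<le> b \<longrightarrow>
          \<Lambda> (N t) r - e \<le> (\<Sum>r\<in>{r}. \<Lambda> (N_scaled j x) r * of_bool (0 < N_scaled j x r)) \<and>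
          (\<Sum>r\<in>{r}. \<Lambda> (N_scaled j x) r * of_bool (0 < N_scaled j x r)) \<le> \<Lambda> (N t) r + e"
        using ev
      proof (rule eventually_mono, intro allI impI)
        fix j x
        assume *: "\<forall>x. 0 \<le> x \<longrightarrow> \<bar>x - t\<bar> < h \<longrightarrow>
            \<Lambda> (N t) r - e \<le> \<Lambda> (N_scaled j x) r * of_bool (0 < N_scaled j x r) \<and>
            \<Lambda> (N_scaled j x) r * of_bool (0 < N_scaled j x r) \<le> \<Lambda> (N t) r + e" and "a \<le> x" "x \<le> b"
        then have "0 \<le> x" "\<bar>x - t\<bar> < h" using that by linarith+
        with * show "\<Lambda> (N t) r - e \<le> (\<Sum>r\<in>{r}. \<Lambda> (N_scaled j x) r * of_bool (0 < N_scaled j x r)) \<and>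
            (\<Sum>r\<in>{r}. \<Lambda> (N_scaled j x) r * of_bool (0 < N_scaled j x r)) \<le> \<Lambda> (N t) r + e"
          by (simp del: sum_mult_of_bool_eq)
      qed
      from D_increment_bounds[OF that(1,2) this] show ?thesis
        by (simp add: abs_le_iff algebra_simps)
    qed
    show "\<exists>h>0. \<forall>s\<in>{0..}. norm (s - t) < h \<longrightarrow>
        norm (D s r - D t r - \<Lambda> (N t) r * (s - t)) \<le> e * norm (s - t)"
    proof (intro exI conjI ballI impI)
      fix s assume s: "s \<in> {0..}" "norm (s - t) < h"
      show "norm (D s r - D t r - \<Lambda> (N t) r * (s - t)) \<le> e * norm (s - t)"
      proof (cases "t \<le> s")
        case True
        then show ?thesis using incr[of t s] s t \<open>0 < h\<close> by simp
      next
        case False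
        have "D s r - D t r - \<Lambda> (N t) r * (s - t) = - (D t r - D s r - \<Lambda> (N t) r * (t - s))"
          by (simp add: algebra_simps)
        then show ?thesis using incr[of s t] s t False \<open>0 < h\<close> by simp
      qed
    qed (rule \<open>0 < h\<close>)
  qed
  then have "((\<lambda>t. D t r) has_real_derivative \<Lambda> (N t) r) (at t within {0..})"
    by (simp add: has_field_derivative_def)
  then have "((\<lambda>t. N 0 r + lam r * t - D t r / \<nu> r) has_real_derivative
      lam r - \<Lambda> (N t) r / \<nu> r) (at t within {0..})"
    using \<nu>_pos[of r] by (auto intro!: derivative_eq_intros)
  then show ?thesis
    by (rule has_field_derivative_transform_within[where d = 1])
      (auto simp: t intro: N_balance[symmetric])
qed

text \<open>In every scaled network the allocation to a bottleneck link \<open>l\<close> is at most \<open>c l\<close>, which is exactly the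
  rate at which work for \<open>l\<close> arrives.\<close>
lemma workload_mono:
  assumes l: "l \<in> bottlenecks" and st: "0 \<le> s" "s \<le> t"
  shows "workload (N s) l \<le> workload (N t) l"
proof -
  have "\<forall>\<^sub>F j in sequentially. \<forall>x. s \<le> x \<longrightarrow> x \<le> t \<longrightarrow>
      0 \<le> (\<Sum>r | l \<in> route r. \<Lambda> (N_scaled j x) r * of_bool (0 < N_scaled j x r)) \<and>
      (\<Sum>r | l \<in> route r. \<Lambda> (N_scaled j x) r * of_bool (0 < N_scaled j x r)) \<le> c l"
  proof (intro always_eventually allI impI conjI)
    fix j x
    note feas = allocation_feasible[of "N_scaled j x", OF N_scaled_nonneg]
    show "0 \<le> (\<Sum>r | l \<in> route r. \<Lambda> (N_scaled j x) r * of_bool (0 < N_scaled j x r))"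
      using feas by (auto simp: feasible_def intro!: sum_nonneg)
    have "(\<Sum>r | l \<in> route r. \<Lambda> (N_scaled j x) r * of_bool (0 < N_scaled j x r)) \<le> (\<Sum>r | l \<in> route r. \<Lambda> (N_scaled j x) r)"
      using feas by (intro sum_mono) (auto simp: feasible_def of_bool_def)
    also have "\<dots> \<le> c l" using feas by (simp add: feasible_def)
    finally show "(\<Sum>r | l \<in> route r. \<Lambda> (N_scaled j x) r * of_bool (0 < N_scaled j x r)) \<le> c l" .
  qed
  then have "(\<Sum>r | l \<in> route r. D t r - D s r) \<le> c l * (t - s)"
    by (rule D_increment_bounds(2)[OF st])
  also have "c l * (t - s) = (\<Sum>r | l \<in> route r. \<rho> r * (t - s))"
    using l by (simp add: bottleneck_def sum_distrib_right[symmetric])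
  finally have "0 \<le> (\<Sum>r | l \<in> route r. \<rho> r * (t - s) - (D t r - D s r))"
    by (simp add: sum_subtractf)
  also have "\<dots> = (\<Sum>r | l \<in> route r. \<nu> r * N t r - \<nu> r * N s r)"
  proof (rule sum.cong)
    fix r
    show "\<rho> r * (t - s) - (D t r - D s r) = \<nu> r * N t r - \<nu> r * N s r"
      using N_balance[of t r] N_balance[of s r] st \<nu>_pos[of r]
      by (simp add: offered_load_def field_simps)
  qed simp
  finally show ?thesis by (simp add: workload_def sum_subtractf)
qed

lemma W_eq_workload:
  assumes l: "l \<in> bottlenecks" and t: "0 \<le> t"
  shows "W t l = workload (N t) l"
proof -
  have "(\<lambda>j. \<nu>k (\<sigma> j) r) \<longlonglongrightarrow> \<nu> r" for r
    using LIMSEQ_subseq_LIMSEQ[OF \<nu>_limit \<sigma>] by (simp add: o_def)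
  then have "(\<lambda>j. \<Sum>r | l \<in> route r. \<nu>k (\<sigma> j) r * N_scaled j t r) \<longlonglongrightarrow> workload (N t) l"
    unfolding workload_def by (intro tendsto_intros N_scaled_tendsto t)
  moreover have "\<forall>\<^sub>F j in sequentially.
      (\<Sum>r | l \<in> route r. \<nu>k (\<sigma> j) r * N_scaled j t r) = Wk (\<sigma> j) (scaling j * t) l / scaling j"
    using eventually_ge_at_top[of 1]
  proof eventually_elim
    case (elim j)
    then show ?case
      using network_path_workload[OF scaled_path[OF elim] _ l, of "scaling j * t"] scaling_pos[OF elim] t
      by (simp add: N_scaled_def sum_divide_distrib)
  qed
  ultimately have "(\<lambda>j. Wk (\<sigma> j) (scaling j * t) l / scaling j) \<longlonglongrightarrow> workload (N t) l"
    by (rule Lim_transform_eventually)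
  then show ?thesis
    using scaled_limit_pointwise[OF W_limit[OF l] t] LIMSEQ_unique by blast
qed

theorem fluid_path_N: "fluid_path N"
  unfolding fluid_path_def
  using N_nonneg N_Lipschitz N_has_derivative workload_mono by blast

end

section \<open>Uniform attraction\<close>

theorem theorem6:
  fixes route :: "'r::finite \<Rightarrow> 'l::finite set"
    and c :: "'l \<Rightarrow> real"
    and lam \<nu> :: "'r \<Rightarrow> real"
    and U :: "'r \<Rightarrow> real \<Rightarrow> real \<Rightarrow> real"
    and \<Lambda> :: "('r \<Rightarrow> real) \<Rightarrow> 'r \<Rightarrow> real"
    and B :: real
  assumes "\<And>r. route r \<noteq> {}"
    and "\<And>l. 0 < c l"
    and "\<And>r. 0 < lam r"
    and "\<And>r. 0 < \<nu> r"
    and "offered_load lam \<nu> \<in> feasible route c"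
    and "\<And>r. utility_function (U r)"
    and "utility_maximizing route c U \<Lambda>"
    and "radially_homogeneous \<Lambda>"
    and "0 < B"
  shows "\<exists>T :: real \<Rightarrow> real. (\<forall>\<epsilon>>0. 0 < T \<epsilon>) \<and>
    (\<forall>(P :: 'w measure) u v lamk \<nu>k \<omega> N D W Y.
       stochastic_primitives P u v lamk \<nu>k lam \<nu> \<longrightarrow>
       \<omega> \<in> space P \<longrightarrow>
       fluid_limit route c lam \<nu> \<Lambda> \<nu>k (\<lambda>k r i. u k r i \<omega>) (\<lambda>k r i. v k r i \<omega>) N D W Y \<longrightarrow>
       l1norm (N 0) \<le> B \<longrightarrow>
       (\<exists>Ninf Winf.
          (\<forall>\<epsilon>>0. \<forall>t>T \<epsilon>. l1norm (\<lambda>r. N t r - Ninf r) < \<epsilon>) \<and>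
          (\<forall>l\<in>bottleneck route c (offered_load lam \<nu>). ((\<lambda>t. W t l) \<longlongrightarrow> Winf l) at_top) \<and>
          Ninf = fixed_point route c lam \<nu> U Winf))"
proof -
  interpret utility_network route c lam \<nu> U \<Lambda>
    by unfold_locales (use assms in auto)
  \<comment> \<open>A bound for the initial cost: every component of \<open>N 0\<close> is at most \<open>B\<close>.\<close>
  define K where "K = (\<Sum>r\<in>UNIV. class_cost lam \<nu> U r B)"
  have "0 \<le> K"
    using \<open>0 < B\<close> by (simp add: K_def sum_nonneg class_cost_nonneg)
  from fluid_paths_uniformly_attracted[OF this] obtain T where T_pos: "\<forall>\<epsilon>>0. 0 < T \<epsilon>"
    and T: "\<forall>N. fluid_path N \<longrightarrow> total_cost (N 0) \<le> K \<longrightarrow>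
      (\<exists>m. (\<forall>r. 0 \<le> m r) \<and> dissipation m = 0 \<and>
        (\<forall>\<epsilon>>0. \<forall>t>T \<epsilon>. l1norm (\<lambda>r. N t r - m r) < \<epsilon>))"
    by (elim exE conjE)
  show ?thesis
  proof (intro exI[of _ T] conjI T_pos allI impI)
    fix P :: "'w measure" and u v lamk \<nu>k \<omega> N D W Y
    assume primitives: "stochastic_primitives P u v lamk \<nu>k lam \<nu>"
      and limit: "fluid_limit route c lam \<nu> \<Lambda> \<nu>k (\<lambda>k r i. u k r i \<omega>) (\<lambda>k r i. v k r i \<omega>) N D W Y"
      and initial: "l1norm (N 0) \<le> B"
    have "\<forall>r. (\<lambda>k. lamk k r) \<longlonglongrightarrow> lam r \<and> (\<lambda>k. \<nu>k k r) \<longlonglongrightarrow> \<nu> r"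
      using primitives unfolding stochastic_primitives_def by (elim conjE)
    then have \<nu>k: "(\<lambda>k. \<nu>k k r) \<longlonglongrightarrow> \<nu> r" for r by blast
    obtain \<sigma> Nk Dk Wk Yk where
      "fluid_scaling route c lam \<nu> U \<Lambda> \<sigma> \<nu>k (\<lambda>k r i. u k r i \<omega>) (\<lambda>k r i. v k r i \<omega>) Nk Dk Wk Yk N D W"
    proof -
      from limit obtain \<sigma> Nk Dk Wk Yk where
        "strict_mono \<sigma>"
        "\<forall>k\<ge>1. network_path route bottlenecks \<rho> \<Lambda> (\<nu>k k) (\<lambda>r i. u k r i \<omega>) (\<lambda>r i. v k r i \<omega>)
          (Nk k) (Dk k) (Wk k) (Yk k)"
        "\<forall>r. scaled_limit \<sigma> (\<lambda>k t. real (renewal_count (\<lambda>i. u k r i \<omega>) t)) (\<lambda>t. lam r * t)"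
        "\<forall>r. scaled_limit \<sigma> (\<lambda>k y. real (renewal_count (\<lambda>i. v k r i \<omega>) y)) (\<lambda>y. y / \<nu> r)"
        "\<forall>r. scaled_limit \<sigma> (\<lambda>k t. real (Nk k t r)) (\<lambda>t. N t r)"
        "\<forall>r. scaled_limit \<sigma> (\<lambda>k t. Dk k t r) (\<lambda>t. D t r)"
        "\<forall>l\<in>bottlenecks. scaled_limit \<sigma> (\<lambda>k t. Wk k t l) (\<lambda>t. W t l)"
        unfolding fluid_limit_def Let_def by (elim exE conjE)
      then have "fluid_scaling route c lam \<nu> U \<Lambda> \<sigma> \<nu>k (\<lambda>k r i. u k r i \<omega>) (\<lambda>k r i. v k r i \<omega>)
          Nk Dk Wk Yk N D W"
        using \<nu>k by (intro fluid_scaling.intro fluid_scaling_axioms.intro utility_network_axioms) auto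
      then show thesis by (rule that)
    qed
    then interpret scaling: fluid_scaling route c lam \<nu> U \<Lambda> \<sigma> \<nu>k
      "\<lambda>k r i. u k r i \<omega>" "\<lambda>k r i. v k r i \<omega>" Nk Dk Wk Yk N D W .
    have "total_cost (N 0) \<le> K"
      unfolding total_cost_def K_def
    proof (intro sum_mono class_cost_mono)
      fix r
      show "0 \<le> N 0 r" by (simp add: scaling.N_nonneg)
      show "N 0 r \<le> B" using abs_le_l1norm[of "N 0" r] initial by simp
    qed
    then obtain m where m: "\<And>r. 0 \<le> m r" "dissipation m = 0"
      and attracted: "\<forall>\<epsilon>>0. \<forall>t>T \<epsilon>. l1norm (\<lambda>r. N t r - m r) < \<epsilon>"
      using T[rule_format, OF scaling.fluid_path_N] by blast
    have N_lim: "((\<lambda>t. N t r) \<longlongrightarrow> m r) at_top" for r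
    proof (rule tendstoI)
      fix e :: real assume "0 < e"
      show "\<forall>\<^sub>F t in at_top. dist (N t r) (m r) < e"
        using eventually_gt_at_top[of "T e"]
      proof (rule eventually_mono)
        fix t assume "T e < t"
        then have "l1norm (\<lambda>r. N t r - m r) < e" using attracted \<open>0 < e\<close> by blast
        then show "dist (N t r) (m r) < e"
          using abs_le_l1norm[of "\<lambda>r. N t r - m r" r] by (simp add: dist_real_def)
      qed
    qed
    have "((\<lambda>t. W t l) \<longlongrightarrow> workload m l) at_top" if "l \<in> bottlenecks" for l
    proof (rule Lim_transform_eventually[OF workload_tendsto[OF N_lim]])
      show "\<forall>\<^sub>F t in at_top. workload (N t) l = W t l"
        using eventually_ge_at_top[of 0]
        by (rule eventually_mono) (simp add: scaling.W_eq_workload that)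
    qed
    then show "\<exists>Ninf Winf.
        (\<forall>\<epsilon>>0. \<forall>t>T \<epsilon>. l1norm (\<lambda>r. N t r - Ninf r) < \<epsilon>) \<and>
        (\<forall>l\<in>bottlenecks. ((\<lambda>t. W t l) \<longlongrightarrow> Winf l) at_top) \<and>
        Ninf = fixed_point route c lam \<nu> U Winf"
      using attracted stationary_eq_fixed_point[OF m]
      by (intro exI[of _ m] exI[of _ "workload m"]) auto
  qed
qed

end
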